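(* Let $B$ be a Boolean $\sigma$-algebra. Then $B$ is a measure algebra if and only if there is a countable family $\{C_n\}_{n=1}^\infty$ of subsets of $B^+$ with $B^+=\bigcup_{n=1}^\infty C_n$ such that (i) for every $n$ there is an integer $K(n)$ such that every antichain contained in $C_n$ has at most $K(n)$ elements; (ii) if $\{a_n\}_{n=1}^\infty$ is a sequence in $B$ with $a_n\notin C_n$ for each $n$, then $\lim_n a_n=\mathbf 0$; and (iii) for every $k$, if $\{a_n\}_{n=1}^\infty$ is a sequence in $B$ with $\lim_n a_n=\mathbf 0$, then $a_n\notin C_k$ for all but finitely many $n$.
   Context: A Boolean algebra $B$ is an algebra of subsets of a nonempty set $X$ with operations $a\cup b$, $a\cap b$, $-a=X-a$, zero $\mathbf 0=\emptyset$ and unit $\mathbf 1=X$ (so $\mathbf 0\neq\mathbf 1$), ordered by inclusion. $B$ is a Boolean $\sigma$-algebra if every countable $A\subset B$ has a supremum $\bigvee A$ and an infimum $\bigwedge A$ in the ordering of $B$. $B^+=B-\{\mathbf 0\}$. A measure on a Boolean $\sigma$-algebra $B$ is a real-valued function $m$ on $B$ with: $m(\mathbf 0)=0$, $m(a)>0$ for $a\ne\mathbf 0$, $m(\mathbf 1)=1$; $m(a)\le m(b)$ if $a\subset b$; $m(a\cup b)=m(a)+m(b)$ if $a\cap b=\mathbf 0$; and $m(\bigvee_{n=1}^\infty a_n)=\sum_{n=1}^\infty m(a_n)$ whenever the $a_n$ are pairwise disjoint. A measure algebra is a Boolean $\sigma$-algebra that carries a measure. An antichain is a set $A\subset B^+$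 such that $a\cap b=\mathbf 0$ for all distinct $a,b\in A$. For a sequence $\{a_n\}_n$ in a Boolean $\sigma$-algebra, $\limsup_n a_n=\bigwedge_{n=1}^\infty\bigvee_{k=n}^\infty a_k$ and $\liminf_n a_n=\bigvee_{n=1}^\infty\bigwedge_{k=n}^\infty a_k$; $\lim_n a_n=a$ means $\limsup_n a_n=\liminf_n a_n=a$. *)

theory Defs
  imports "HOL-Analysis.Sigma_Algebra" "HOL-Library.Lub_Glb"
begin

text \<open>
  A Boolean algebra is an algebra \<open>B\<close> of subsets of a nonempty set \<open>X\<close> (library locale
  \<^locale>\<open>algebra\<close>).  Suprema and infima are taken in the ordering of \<open>B\<close>
  (\<^term>\<open>isLub B\<close>, \<^term>\<open>isGlb B\<close>); they need not be the set-theoretic union and intersection.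
\<close>

definition boolean_sigma_algebra :: "'a set \<Rightarrow> 'a set set \<Rightarrow> bool" where
  "boolean_sigma_algebra X B \<longleftrightarrow>
     algebra X B \<and> X \<noteq> {} \<and>
     (\<forall>A. A \<subseteq> B \<and> countable A \<longrightarrow> (\<exists>s. isLub B A s) \<and> (\<exists>i. isGlb B A i))"

definition bsup :: "'a set set \<Rightarrow> 'a set set \<Rightarrow> 'a set" where
  "bsup B A = (THE s. isLub B A s)"

definition binf :: "'a set set \<Rightarrow> 'a set set \<Rightarrow> 'a set" where
  "binf B A = (THE i. isGlb B A i)"

lemma bsup_eqI: "isLub B A s \<Longrightarrow> bsup B A = s"
  unfolding bsup_def
  by (rule the_equality, assumption, rule subset_antisym)
    (simp_all add: isLub_def leastP_def isUb_def setle_def setge_def)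

lemma binf_eqI: "isGlb B A i \<Longrightarrow> binf B A = i"
  unfolding binf_def
  by (rule the_equality, assumption, rule subset_antisym)
    (simp_all add: isGlb_def greatestP_def isLb_def setle_def setge_def)

lemma isLub_bsup:
  "boolean_sigma_algebra X B \<Longrightarrow> A \<subseteq> B \<Longrightarrow> countable A \<Longrightarrow> isLub B A (bsup B A)"
  unfolding boolean_sigma_algebra_def using bsup_eqI by metis

lemma isGlb_binf:
  "boolean_sigma_algebra X B \<Longrightarrow> A \<subseteq> B \<Longrightarrow> countable A \<Longrightarrow> isGlb B A (binf B A)"
  unfolding boolean_sigma_algebra_def using binf_eqI by metis

text \<open>Only the values of \<open>m\<close> on \<open>B\<close> matter.\<close>

definition boolean_measure :: "'a set \<Rightarrow> 'a set set \<Rightarrow> ('a set \<Rightarrow> real) \<Rightarrow> bool" where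
  "boolean_measure X B m \<longleftrightarrow>
     m {} = 0 \<and> (\<forall>a\<in>B. a \<noteq> {} \<longrightarrow> m a > 0) \<and> m X = 1 \<and>
     (\<forall>a\<in>B. \<forall>b\<in>B. a \<subseteq> b \<longrightarrow> m a \<le> m b) \<and>
     (\<forall>a\<in>B. \<forall>b\<in>B. a \<inter> b = {} \<longrightarrow> m (a \<union> b) = m a + m b) \<and>
     (\<forall>a :: nat \<Rightarrow> 'a set. range a \<subseteq> B \<and> disjoint_family a \<longrightarrow>
        (\<lambda>n. m (a n)) sums m (bsup B (range a)))"

definition measure_algebra :: "'a set \<Rightarrow> 'a set set \<Rightarrow> bool" where
  "measure_algebra X B \<longleftrightarrow> boolean_sigma_algebra X B \<and> (\<exists>m. boolean_measure X B m)"

definition bpos :: "'a set set \<Rightarrow> 'a set set" where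
  "bpos B = B - {{}}"

definition antichain_in :: "'a set set \<Rightarrow> 'a set set \<Rightarrow> bool" where
  "antichain_in B A \<longleftrightarrow> A \<subseteq> bpos B \<and> (\<forall>a\<in>A. \<forall>b\<in>A. a \<noteq> b \<longrightarrow> a \<inter> b = {})"

definition blimsup :: "'a set set \<Rightarrow> (nat \<Rightarrow> 'a set) \<Rightarrow> 'a set" where
  "blimsup B a = binf B (range (\<lambda>n. bsup B (a ` {n..})))"

definition bliminf :: "'a set set \<Rightarrow> (nat \<Rightarrow> 'a set) \<Rightarrow> 'a set" where
  "bliminf B a = bsup B (range (\<lambda>n. binf B (a ` {n..})))"

definition blim :: "'a set set \<Rightarrow> (nat \<Rightarrow> 'a set) \<Rightarrow> 'a set \<Rightarrow> bool" where
  "blim B a l \<longleftrightarrow> blimsup B a = l \<and> bliminf B a = l"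

end

theory Submission
  imports Defs "HOL-Library.Multiset"
begin

text \<open>
  A measure yields the levels of elements of measure at least \<open>2\<^sup>-\<^sup>n\<close>; the Borel--Cantelli argument
  gives (ii), continuity from above gives (iii).

  Conversely, after closing each \<open>C\<^sub>n\<close> upwards, (ii) and (iii) make the complements of the \<open>C\<^sub>n\<close> behave
  like neighbourhoods of zero of a continuous submeasure: for each \<open>k\<close> there is \<open>j\<close> such that the
  union of two elements outside \<open>C\<^sub>j\<close> is outside \<open>C\<^sub>k\<close>. The bound (i) on antichains makes this
  submeasure uniformly exhaustive. The Kalton--Roberts argument, in which a random bipartite
  graph is used to cut the members of a finite family into four pieces each, shows that every
  \<open>C\<^sub>n\<close> has positive intersection number, so by Kelley's theorem there is a finitely additive
  functional bounded away from zero on \<open>C\<^sub>n\<close>. A weighted sum of these is a strictly positive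
  finitely additive \<open>\<mu>\<close>. Its countably additive part stays strictly positive: if it vanished at
  \<open>a\<close>, one could remove from \<open>a\<close> pieces which are small in the sense of the \<open>C\<^sub>n\<close> and be left
  with a set of \<open>\<mu>\<close>-measure zero.
\<close>

section \<open>Expanders and matchings\<close>

text \<open>Peeling: each vertex has four edges and there are more than twice as many neighbours as
  vertices, so some neighbour is met by a single edge. That edge joins the matching, its vertex is
  removed, and no remaining edge reaches the neighbour just used.\<close>

lemma unique_neighbour_matching:
  fixes F :: "'i \<times> nat \<Rightarrow> 'y"
  assumes "finite E"
    and "\<And>D. D \<subseteq> E \<Longrightarrow> D \<noteq> {} \<Longrightarrow> 2 * card D < card (F ` (D \<times> {..<4}))"
  shows "\<exists>f. (\<forall>i\<in>E. f i < 4) \<and> inj_on (\<lambda>i. F (i, f i)) E"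
  using assms
proof (induction "card E" arbitrary: E)
  case 0
  then show ?case by auto
next
  case (Suc n)
  define S where "S = E \<times> {..<4::nat}"
  have fS: "finite S" using Suc.prems(1) by (simp add: S_def)
  have "E \<noteq> {}" using Suc.hyps(2) by auto
  then have exp: "2 * card E < card (F ` S)" using Suc.prems(2)[of E] by (simp add: S_def)
  \<comment> \<open>If every value were taken twice, the image would have at most half of the \<open>4 * card E\<close> edges.\<close>
  have "\<exists>y\<in>F ` S. card {p\<in>S. F p = y} < 2"
  proof (rule ccontr)
    assume "\<not> ?thesis"
    then have "\<And>y. y \<in> F ` S \<Longrightarrow> 2 \<le> card {p\<in>S. F p = y}" by force
    then have "(\<Sum>y\<in>F ` S. 2) \<le> (\<Sum>y\<in>F ` S. card {p\<in>S. F p = y})" by (rule sum_mono)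
    also have "\<dots> = card S" using sum.image_gen[OF fS, of "\<lambda>_. 1::nat" F] by simp
    also have "\<dots> = 4 * card E" by (simp add: S_def card_cartesian_product)
    finally show False using exp by simp
  qed
  then obtain i t where it: "(i, t) \<in> S" and "card {p\<in>S. F p = F (i, t)} < 2" by auto
  then have uniq: "p = (i, t)" if "p \<in> S" "F p = F (i, t)" for p
  proof -
    have "{p, (i,t)} \<subseteq> {p\<in>S. F p = F (i, t)}" using it that by auto
    then have "card {p, (i,t)} < 2"
      using card_mono[of "{p\<in>S. F p = F (i, t)}" "{p, (i,t)}"] fS \<open>card {p\<in>S. F p = F (i, t)} < 2\<close> by simp
    then show ?thesis by (auto split: if_splits simp: card_insert_if)
  qed
  have iE: "i \<in> E" and t4: "t < 4" using it by (auto simp: S_def)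
  have "\<exists>f. (\<forall>i\<in>E - {i}. f i < 4) \<and> inj_on (\<lambda>i. F (i, f i)) (E - {i})"
  proof (rule Suc.hyps(1))
    show "n = card (E - {i})" using Suc.hyps(2) iE Suc.prems(1) by simp
  qed (use Suc.prems in auto)
  then obtain g where g: "\<forall>i\<in>E - {i}. g i < 4" "inj_on (\<lambda>i. F (i, g i)) (E - {i})" by blast
  have new: "F (i', g i') \<noteq> F (i, t)" if "i' \<in> E - {i}" for i'
    using uniq[of "(i', g i')"] that g(1) by (auto simp: S_def)
  have "inj_on (\<lambda>i'. F (i', (g(i := t)) i')) (insert i (E - {i}))"
    unfolding inj_on_insert
  proof
    show "inj_on (\<lambda>i'. F (i', (g(i := t)) i')) (E - {i})"
      using g(2) by (rule inj_on_cong[THEN iffD1, rotated]) auto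
    show "F (i, (g(i := t)) i) \<notin> (\<lambda>i'. F (i', (g(i := t)) i')) ` (E - {i} - {i})"
      using new by fastforce
  qed
  then have "inj_on (\<lambda>i'. F (i', (g(i := t)) i')) E" using iE by (simp add: insert_absorb)
  moreover have "\<forall>i'\<in>E. (g(i := t)) i' < 4" using g(1) t4 by auto
  ultimately show ?case by blast
qed

section \<open>Existence of bipartite expanders by counting\<close>

text \<open>The quotient \<open>n ^ n / fact n\<close> is a single term of the exponential series at
  \<open>n\<close>, hence at most \<open>exp 1 ^ n\<close>.\<close>

lemma power_self_le_fact: "real n ^ n \<le> 3 ^ n * fact n"
proof -
  have "(\<Sum>k\<in>{n}. real n ^ k /\<^sub>R fact k) \<le> exp (real n)"
    unfolding sums_unique[OF exp_converges[of "real n"]]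
    by (rule sum_le_suminf[OF sums_summable[OF exp_converges]]) auto
  also have "\<dots> = exp 1 ^ n" by (simp add: exp_of_nat_mult[symmetric])
  also have "\<dots> \<le> 3 ^ n" using exp_le by (intro power_mono) auto
  finally have "real n ^ n / fact n \<le> 3 ^ n" by (simp add: divide_inverse mult.commute)
  then show ?thesis by (simp add: pos_divide_le_eq)
qed

text \<open>The familiar bound of \<open>n choose k\<close> by \<open>(e * n / k) ^ k\<close>, with
  3 in place of e and multiplied out so that \<open>k = 0\<close> causes no division.\<close>

lemma binomial_mult_power_self_le: "real (n choose k) * real k ^ k \<le> (3 * real n) ^ k"
proof -
  have "real (n choose k) * real k ^ k \<le> real (n choose k) * (3 ^ k * fact k)"
    by (intro mult_left_mono power_self_le_fact) auto
  also have "\<dots> = 3 ^ k * real (fact k * (n choose k))" by simp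
  also have "real (fact k * (n choose k)) \<le> real (n ^ k)"
    using binomial_fact_pow[of n k] by (subst of_nat_le_iff) (simp add: mult.commute)
  finally show ?thesis by (simp add: power_mult_distrib)
qed

text \<open>A union bound. With \<open>s = card D\<close> and \<open>l = card Y\<close>, a
  proportion \<open>(2 * s / l) ^ (4 * s)\<close> of all functions maps the edges at
  \<open>D\<close> into a given \<open>T\<close> of size \<open>2 * s\<close>. Summed over all such
  pairs this is at most \<open>(1/3) ^ s\<close>, and the sum over \<open>s\<close> stays below 1,
  so some function never fails.\<close>

lemma exists_expander:
  fixes I :: "'i set" and Y :: "'y set"
  assumes "finite I" "finite Y"
    and size: "324 * card I * k \<le> (card Y)\<^sup>2" and large: "2 * k \<le> card Y" and pos: "0 < card Y"
  shows "\<exists>F \<in> I \<times> {..<4::nat} \<rightarrow> Y. \<forall>D \<subseteq> I. D \<noteq> {} \<longrightarrow> card D \<le> k \<longrightarrow> 2 * card D < card (F ` (D \<times> {..<4}))"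
proof -
  define S where "S = I \<times> {..<4::nat}"
  define m where "m = card I"
  define l where "l = card Y"
  \<comment> \<open>Count the functions that fail on some \<open>D\<close>, with image inside some \<open>T\<close> of size \<open>2 * card D\<close>.\<close>
  define bad where "bad D T = (\<Pi>\<^sub>E p\<in>S. if p \<in> D \<times> {..<4} then T else Y)" for D :: "'i set" and T :: "'y set"
  define P where "P s = {D. D \<subseteq> I \<and> card D = s} \<times> {T. T \<subseteq> Y \<and> card T = 2 * s}" for s
  define Bad where "Bad = (\<Union>s\<in>{1..k}. \<Union>(D, T)\<in>P s. bad D T)"
  have fS: "finite S" using assms by (simp add: S_def)
  have finP: "finite (P s)" for s using assms by (simp add: P_def)
  have cardP: "card (P s) = (m choose s) * (l choose (2 * s))" for s
    using assms by (simp add: P_def card_cartesian_product n_subsets m_def l_def)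
  have card_bad: "real (card (bad D T)) = (2 * real s / l) ^ (4 * s) * real l ^ (4 * m)"
    if "(D, T) \<in> P s" for D T s
  proof -
    have D: "D \<subseteq> I" "card D = s" "T \<subseteq> Y" "card T = 2 * s" using that by (auto simp: P_def)
    have s: "s \<le> m" using D assms card_mono unfolding m_def by metis
    have sub: "D \<times> {..<4} \<subseteq> S" using D by (auto simp: S_def)
    have "card (bad D T) = (\<Prod>p\<in>S. if p \<in> D \<times> {..<4} then card T else card Y)"
      unfolding bad_def using fS by (subst card_PiE) (auto intro!: prod.cong)
    also have "\<dots> = (\<Prod>p\<in>S \<inter> D \<times> {..<4}. card T) * (\<Prod>p\<in>S - D \<times> {..<4}. card Y)"
      using fS by (subst prod.If_cases) (auto simp: Diff_eq intro!: arg_cong2[where f="(*)"])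
    also have "S \<inter> D \<times> {..<4} = D \<times> {..<4}" using sub by auto
    also have "(\<Prod>p\<in>D \<times> {..<4::nat}. card T) = (2 * s) ^ (4 * s)"
      using D by (simp add: card_cartesian_product mult.commute)
    also have "(\<Prod>p\<in>S - D \<times> {..<4}. card Y) = l ^ (4 * m - 4 * s)"
      using sub finite_subset[OF sub fS] D
      by (simp add: card_Diff_subset S_def card_cartesian_product l_def m_def mult.commute)
    finally have "real (card (bad D T)) = (2 * real s) ^ (4 * s) * real l ^ (4 * m - 4 * s)" by simp
    also have "real l ^ (4 * m - 4 * s) = real l ^ (4 * m) / real l ^ (4 * s)"
      using s pos by (simp add: power_diff l_def)
    finally show ?thesis by (simp add: power_divide)
  qed
  \<comment> \<open>The binomial estimates bound the left side by
    \<open>(108 * m * s / l^2) ^ s\<close>. Since 324 is three times 108, \<open>size\<close> makes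
    the base at most 1/3.\<close>
  have term_le: "real ((m choose s) * (l choose (2 * s))) * (2 * real s / l) ^ (4 * s) \<le> (1 / 3) ^ s"
    if s: "s \<in> {1..k}" for s
  proof -
    have s0: "real s > 0" and l0: "real l > 0" using s pos by (auto simp: l_def)
    have e1: "real s ^ s * real (2 * s) ^ (2 * s) = (4 * real s ^ 3) ^ s"
      unfolding power_mult[of _ 2 s] power_mult_distrib[symmetric]
      by (rule arg_cong[where f = "\<lambda>z. z ^ s"]) (simp add: eval_nat_numeral)
    have e2: "(3 * real m) ^ s * (3 * real l) ^ (2 * s) = (27 * real m * real l ^ 2) ^ s"
      unfolding power_mult[of _ 2 s] power_mult_distrib[symmetric]
      by (rule arg_cong[where f = "\<lambda>z. z ^ s"]) (simp add: eval_nat_numeral)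
    have "(real (m choose s) * real s ^ s) * (real (l choose (2 * s)) * real (2 * s) ^ (2 * s))
        \<le> (3 * real m) ^ s * (3 * real l) ^ (2 * s)"
      by (intro mult_mono binomial_mult_power_self_le) auto
    then have "(real (m choose s) * real (l choose (2 * s))) * (4 * real s ^ 3) ^ s \<le> (27 * real m * real l ^ 2) ^ s"
      unfolding e2 e1[symmetric] by (simp only: mult_ac)
    then have "(real (m choose s) * real (l choose (2 * s))) * (4 * real s ^ 3) ^ s * (4 * real s / real l ^ 4) ^ s
      \<le> (27 * real m * real l ^ 2) ^ s * (4 * real s / real l ^ 4) ^ s"
      by (rule mult_right_mono) simp
    moreover have "(2 * real s / l) ^ (4 * s) = (4 * real s ^ 3) ^ s * (4 * real s / real l ^ 4) ^ s"
      unfolding power_mult[of _ 4 s] power_mult_distrib[symmetric]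
      by (rule arg_cong[where f = "\<lambda>z. z ^ s"]) (simp add: eval_nat_numeral)
    moreover have "(27 * real m * real l ^ 2) ^ s * (4 * real s / real l ^ 4) ^ s = (108 * real m * real s / real l ^ 2) ^ s"
      unfolding power_mult_distrib[symmetric]
      by (rule arg_cong[where f = "\<lambda>z. z ^ s"]) (use l0 in \<open>simp add: eval_nat_numeral\<close>)
    moreover have "(108 * real m * real s / real l ^ 2) ^ s \<le> (1/3) ^ s"
    proof (rule power_mono)
      have "324 * m * s \<le> 324 * m * k" using s by simp
      also have "\<dots> \<le> l ^ 2" using size by (simp add: m_def l_def)
      finally have "real (324 * m * s) \<le> real (l ^ 2)" by (rule of_nat_mono)
      then show "108 * real m * real s / real l ^ 2 \<le> 1 / 3" using l0 by (simp add: field_simps)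
    qed simp
    ultimately show ?thesis by (simp add: mult_ac)
  qed
  have "real (card Bad) \<le> real (\<Sum>s\<in>{1..k}. \<Sum>(D, T)\<in>P s. card (bad D T))"
    unfolding Bad_def of_nat_le_iff
    by (intro order_trans[OF card_UN_le] sum_mono finP)
       (auto intro!: order_trans[OF card_UN_le] finP sum_mono)
  also have "\<dots> = (\<Sum>s\<in>{1..k}. \<Sum>(D, T)\<in>P s. (2 * real s / l) ^ (4 * s) * real l ^ (4 * m))"
    unfolding of_nat_sum by (intro sum.cong refl) (auto simp: card_bad)
  also have "\<dots> = (\<Sum>s\<in>{1..k}. (real ((m choose s) * (l choose (2 * s))) * (2 * real s / l) ^ (4 * s)) * real l ^ (4 * m))"
    by (intro sum.cong refl) (simp add: cardP split_def mult_ac)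
  also have "\<dots> \<le> (\<Sum>s\<in>{1..k}. (1/3) ^ s * real l ^ (4 * m))"
    by (intro sum_mono mult_right_mono term_le) auto
  also have "\<dots> = (\<Sum>s\<in>{1..k}. (1/3) ^ s) * real l ^ (4 * m)" by (simp add: sum_distrib_right)
  also have "\<dots> < 1 * real l ^ (4 * m)"
  proof (rule mult_strict_right_mono)
    have "(\<Sum>s\<in>{1..k}. (1/3::real) ^ s) = (1 - (1/3) ^ k) / 2"
      by (induction k) simp_all
    also have "\<dots> < 1" by (simp add: add_pos_pos field_simps)
    finally show "(\<Sum>s\<in>{1..k}. (1/3::real) ^ s) < 1" .
    show "0 < real l ^ (4 * m)" using pos by (simp add: l_def)
  qed
  also have "\<dots> = real (card (\<Pi>\<^sub>E p\<in>S. Y))"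
    using fS by (simp add: card_PiE S_def card_cartesian_product l_def m_def mult.commute)
  finally have "card Bad < card (\<Pi>\<^sub>E p\<in>S. Y)" by simp
  moreover have "finite (\<Pi>\<^sub>E p\<in>S. Y)" using fS assms by (intro finite_PiE) auto
  moreover have "finite Bad"
  proof (rule finite_subset)
    have "bad D T \<subseteq> (\<Pi>\<^sub>E p\<in>S. Y)" if "(D, T) \<in> P s" for D T s
      unfolding bad_def using that by (intro PiE_mono) (auto simp: P_def)
    then show "Bad \<subseteq> (\<Pi>\<^sub>E p\<in>S. Y)" unfolding Bad_def by fast
  qed fact
  ultimately obtain F where F: "F \<in> (\<Pi>\<^sub>E p\<in>S. Y)" "F \<notin> Bad"
    by (metis card_mono not_less subsetI)
  show ?thesis
  proof (intro bexI[of _ F] allI impI)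
    show "F \<in> I \<times> {..<4} \<rightarrow> Y" using F(1) by (auto simp: S_def PiE_iff)
    fix D assume D: "D \<subseteq> I" "D \<noteq> {}" "card D \<le> k"
    show "2 * card D < card (F ` (D \<times> {..<4}))"
    proof (rule ccontr)
      assume small: "\<not> ?thesis"
      have img: "F ` (D \<times> {..<4}) \<subseteq> Y" using F(1) D(1) by (auto simp: S_def PiE_iff)
      \<comment> \<open>\<open>Bad\<close> is built from sets \<open>T\<close> of size exactly
        \<open>2 * card D\<close>; \<open>large\<close> leaves room in \<open>Y\<close> to enlarge
        the image to one of them.\<close>
      obtain T where T: "F ` (D \<times> {..<4}) \<subseteq> T" "T \<subseteq> Y" "card T = 2 * card D"
        using exists_subset_between[OF _ _ img \<open>finite Y\<close>, of "2 * card D"] small D(3) large by auto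
      have "card D \<noteq> 0" using D assms finite_subset by (metis card_0_eq)
      moreover have "F \<in> bad D T" using F(1) T by (auto simp: bad_def PiE_iff)
      ultimately have "F \<in> Bad" unfolding Bad_def using D T
        by (intro UN_I[of "card D"] UN_I[of "(D, T)"]) (auto simp: P_def)
      then show False using F(2) by simp
    qed
  qed
qed

section \<open>Kelley's theorem\<close>

text \<open>By \<open>inter\<close> the sums of functions \<open>indicator c - \<delta>\<close> have
  nonnegative supremum. A maximal semigroup \<open>G\<close> of this kind serves as the set where
  the functional sought is nonnegative, and \<open>\<mu> a\<close> is read off as the supremum of
  the \<open>t\<close> with \<open>indicator a - t\<close> in \<open>G\<close>.\<close>

lemma exists_charge_of_intersection_number:
  fixes X :: "'a set" and C :: "'a set set" and \<delta> :: real
  assumes X: "X \<noteq> {}"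
    and inter: "\<And>M. set_mset M \<subseteq> C \<Longrightarrow> \<exists>x\<in>X. \<delta> * real (size M) \<le> (\<Sum>c\<in>#M. indicator c x)"
  shows "\<exists>\<mu> :: 'a set \<Rightarrow> real. (\<forall>a. 0 \<le> \<mu> a \<and> \<mu> a \<le> 1) \<and>
    (\<forall>a b. a \<inter> b = {} \<longrightarrow> \<mu> (a \<union> b) = \<mu> a + \<mu> b) \<and> (\<forall>c\<in>C. \<delta> \<le> \<mu> c)"
proof -
  \<comment> \<open>A maximal additive semigroup of functions with nonnegative supremum acts as a half space; it
    replaces the Hahn--Banach theorem.\<close>
  define good :: "('a \<Rightarrow> real) set \<Rightarrow> bool" where
    "good G \<longleftrightarrow> (\<forall>f\<in>G. \<forall>g\<in>G. (\<lambda>x. f x + g x) \<in> G) \<and> (\<forall>g\<in>G. \<forall>e>0. \<exists>x\<in>X. - e < g x)" for G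
  define G0 where "G0 = {\<lambda>x. (\<Sum>c\<in>#M. indicator c x - \<delta>) | M. set_mset M \<subseteq> C}"
  have "good G0"
    unfolding good_def
  proof (intro conjI ballI allI impI)
    fix f g assume "f \<in> G0" "g \<in> G0"
    then obtain M N where "set_mset M \<subseteq> C" "set_mset N \<subseteq> C"
      "f = (\<lambda>x. (\<Sum>c\<in>#M. indicator c x - \<delta>))" "g = (\<lambda>x. (\<Sum>c\<in>#N. indicator c x - \<delta>))"
      by (auto simp: G0_def)
    then show "(\<lambda>x. f x + g x) \<in> G0" unfolding G0_def by (auto intro!: exI[of _ "M + N"])
  next
    fix g and e :: real assume "g \<in> G0" "e > 0"
    then obtain M where M: "set_mset M \<subseteq> C" "g = (\<lambda>x. (\<Sum>c\<in>#M. indicator c x - \<delta>))"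
      by (auto simp: G0_def)
    have "g x = (\<Sum>c\<in>#M. indicator c x) - \<delta> * real (size M)" for x
      unfolding M(2) by (induction M) (auto simp: algebra_simps)
    then show "\<exists>x\<in>X. - e < g x" using inter[OF M(1)] \<open>e > 0\<close> by force
  qed
  have "\<exists>G\<in>{G. good G \<and> G0 \<subseteq> G}. \<forall>H\<in>{G. good G \<and> G0 \<subseteq> G}. G \<subseteq> H \<longrightarrow> H = G"
  proof (rule subset_Zorn_nonempty)
    show "{G. good G \<and> G0 \<subseteq> G} \<noteq> {}" using \<open>good G0\<close> by auto
  next
    fix \<G> assume ne: "\<G> \<noteq> {}" and ch: "subset.chain {G. good G \<and> G0 \<subseteq> G} \<G>"
    have gd: "\<And>G. G \<in> \<G> \<Longrightarrow> good G \<and> G0 \<subseteq> G" using ch by (auto simp: subset.chain_def)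
    have "good (\<Union>\<G>)"
      unfolding good_def
    proof (intro conjI ballI allI impI)
      fix f g assume "f \<in> \<Union>\<G>" "g \<in> \<Union>\<G>"
      then obtain F G where FG: "F \<in> \<G>" "G \<in> \<G>" "f \<in> F" "g \<in> G" by auto
      then have "F \<subseteq> G \<or> G \<subseteq> F" using ch by (auto simp: subset_chain_def)
      then obtain H where "H \<in> \<G>" "f \<in> H" "g \<in> H" using FG by blast
      then show "(\<lambda>x. f x + g x) \<in> \<Union>\<G>" using gd[of H] unfolding good_def by blast
    next
      fix g and e :: real assume "g \<in> \<Union>\<G>" "e > 0"
      then show "\<exists>x\<in>X. - e < g x" using gd unfolding good_def by blast
    qed
    moreover have "G0 \<subseteq> \<Union>\<G>" using gd ne by blast
    ultimately show "\<Union>\<G> \<in> {G. good G \<and> G0 \<subseteq> G}" by simp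
  qed
  then obtain G where G: "good G" "G0 \<subseteq> G" and max: "\<And>H. good H \<Longrightarrow> G \<subseteq> H \<Longrightarrow> H = G"
    by (smt (verit) mem_Collect_eq order_trans)
  have zero: "(\<lambda>x. 0) \<in> G"
    using G(2) by (rule subsetD) (auto simp: G0_def intro!: exI[of _ "{#}"])
  have add: "(\<lambda>x. f x + g x) \<in> G" if "f \<in> G" "g \<in> G" for f g
    using G(1) that unfolding good_def by blast
  have sup: "\<exists>x\<in>X. - e < g x" if "g \<in> G" "e > 0" for g e
    using G(1) that unfolding good_def by blast
  have scale: "(\<lambda>x. real n * f x) \<in> G" if "f \<in> G" for f n
  proof (induction n)
    case 0 then show ?case using zero by simp
  next
    case (Suc n) then show ?case using add[OF \<open>f \<in> G\<close> Suc] by (simp add: distrib_right)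
  qed
  \<comment> \<open>Maximality in usable form: if adding natural multiples of \<open>f\<close> to
    members of \<open>G\<close> never makes the supremum negative, the semigroup \<open>H\<close>
    they form is good and therefore equals \<open>G\<close>.\<close>
  have ext: "f \<in> G"
    if f: "\<And>g n e. g \<in> G \<Longrightarrow> e > 0 \<Longrightarrow> \<exists>x\<in>X. - e < g x + real n * f x" for f
  proof -
    define H where "H = {\<lambda>x. g x + real n * f x | g n. g \<in> G}"
    have "good H"
      unfolding good_def
    proof (intro conjI ballI allI impI)
      fix h h' assume "h \<in> H" "h' \<in> H"
      then obtain g n g' n' where h: "g \<in> G" "h = (\<lambda>x. g x + real n * f x)"
        "g' \<in> G" "h' = (\<lambda>x. g' x + real n' * f x)" by (auto simp: H_def)
      have "(\<lambda>x. h x + h' x) = (\<lambda>x. (g x + g' x) + real (n + n') * f x)"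
        by (simp add: h algebra_simps)
      then show "(\<lambda>x. h x + h' x) \<in> H"
        unfolding H_def using add[OF h(1,3)] by (intro CollectI exI conjI)
    next
      fix h and e :: real assume "h \<in> H" "e > 0"
      then show "\<exists>x\<in>X. - e < h x" using f by (auto simp: H_def)
    qed
    moreover have "g \<in> H" if "g \<in> G" for g
      using that unfolding H_def by (intro CollectI exI[of _ g] exI[of _ 0]) simp
    ultimately have "H = G" using max by blast
    moreover have "f \<in> H"
      using zero unfolding H_def by (intro CollectI exI[of _ "\<lambda>_. 0"] exI[of _ 1]) simp
    ultimately show ?thesis by simp
  qed
  have up: "h \<in> G" if "f \<in> G" "\<And>x. x \<in> X \<Longrightarrow> f x \<le> h x" for f h
  proof (rule ext)
    fix g n and e :: real assume "g \<in> G" "e > 0"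
    then obtain x where x: "x \<in> X" "- e < g x + real n * f x"
      using sup[OF add[OF _ scale[OF \<open>f \<in> G\<close>]]] by blast
    moreover have "real n * f x \<le> real n * h x" using that x by (intro mult_left_mono) auto
    ultimately show "\<exists>x\<in>X. - e < g x + real n * h x" by force
  qed
  define T where "T a = {t::real. (\<lambda>x. indicator a x - t) \<in> G}" for a
  define \<mu> where "\<mu> a = Sup (T a)" for a
  have T0: "0 \<in> T a" for a using up[OF zero] by (simp add: T_def)
  have T1: "t \<le> 1" if t: "t \<in> T a" for t a
  proof (rule ccontr)
    assume "\<not> t \<le> 1"
    then obtain x where "- (t - 1) < indicator a x - t"
      using sup[of "\<lambda>x. indicator a x - t" "t - 1"] t unfolding T_def by auto
    then show False by (cases "x \<in> a") auto
  qed
  have bdd: "bdd_above (T a)" for a using T1 by (rule bdd_aboveI)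
  have le_mu: "t \<le> \<mu> a" if "t \<in> T a" for t a
    unfolding \<mu>_def using that bdd by (rule cSup_upper)
  have mu_le: "\<mu> a \<le> u" if "\<And>t. t \<in> T a \<Longrightarrow> t \<le> u" for u a
    unfolding \<mu>_def using that T0 by (intro cSup_least) auto
  have "\<mu> (a \<union> b) = \<mu> a + \<mu> b" if ab: "a \<inter> b = {}" for a b
  proof (rule antisym)
    have ind: "indicator (a \<union> b) x = indicator a x + (indicator b x :: real)" for x
      using ab by (auto simp: indicator_def)
    show "\<mu> a + \<mu> b \<le> \<mu> (a \<union> b)"
    proof -
      have "t + s \<le> \<mu> (a \<union> b)" if "t \<in> T a" "s \<in> T b" for s t
      proof (rule le_mu)
        show "t + s \<in> T (a \<union> b)"
          using add[of "\<lambda>x. indicator a x - t" "\<lambda>x. indicator b x - s"] that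
          by (simp add: T_def ind algebra_simps)
      qed
      then have "\<mu> a \<le> \<mu> (a \<union> b) - s" if "s \<in> T b" for s
        using that by (intro mu_le) (simp add: le_diff_eq)
      then have "\<mu> b \<le> \<mu> (a \<union> b) - \<mu> a" by (intro mu_le) (simp add: algebra_simps)
      then show ?thesis by simp
    qed
    show "\<mu> (a \<union> b) \<le> \<mu> a + \<mu> b"
    proof (rule mu_le, rule ccontr)
      fix u assume u: "u \<in> T (a \<union> b)" and less: "\<not> u \<le> \<mu> a + \<mu> b"
      define h where "h = (u - \<mu> a - \<mu> b) / 2"
      have h: "h > 0" using less by (simp add: h_def)
      \<comment> \<open>\<open>\<mu> a + h\<close> exceeds the supremum of \<open>T a\<close>, so
        the corresponding function is outside \<open>G\<close>. By \<open>ext\<close> some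
        combination with a member of \<open>G\<close> is then uniformly negative.\<close>
      have neg: "\<exists>g n e. g \<in> G \<and> e > 0 \<and> (\<forall>x\<in>X. g x + real n * (indicator a x - (\<mu> a + h)) \<le> - e)" for a
      proof -
        have "\<mu> a + h \<notin> T a" using le_mu[of "\<mu> a + h" a] h by auto
        then show ?thesis using ext[of "\<lambda>x. indicator a x - (\<mu> a + h)"] by (force simp: T_def not_less)
      qed
      obtain f n e where f: "f \<in> G" "e > 0" "\<And>x. x \<in> X \<Longrightarrow> f x + real n * (indicator a x - (\<mu> a + h)) \<le> - e"
        using neg[of a] by blast
      obtain g m d where g: "g \<in> G" "d > 0" "\<And>x. x \<in> X \<Longrightarrow> g x + real m * (indicator b x - (\<mu> b + h)) \<le> - d"
        using neg[of b] by blast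
      have n0: "n > 0"
      proof (rule ccontr)
        assume "\<not> n > 0"
        then have "\<And>x. x \<in> X \<Longrightarrow> f x \<le> - e" using f(3) by simp
        then show False using sup[OF f(1,2)] by force
      qed
      have uu: "u = (\<mu> a + h) + (\<mu> b + h)" by (simp add: h_def field_simps)
      \<comment> \<open>Cross-multiplying by \<open>m\<close> and \<open>n\<close> gives both
        indicators the coefficient \<open>n * m\<close>, so they merge into that of
        \<open>a \<union> b\<close>. The result lies in \<open>G\<close> but is at most
        \<open>- n * d\<close> on \<open>X\<close>.\<close>
      define k where "k = (\<lambda>x. (real m * f x + real n * g x) + real (n * m) * (indicator (a \<union> b) x - u))"
      have "k \<in> G" unfolding k_def using u f(1) g(1) by (intro add scale) (simp_all add: T_def)
      then obtain x where x: "x \<in> X" "- (real n * d) < k x"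
        using sup[of k "real n * d"] n0 g(2) by auto
      have "k x = real m * (f x + real n * (indicator a x - (\<mu> a + h))) + real n * (g x + real m * (indicator b x - (\<mu> b + h)))"
        unfolding k_def uu ind by (simp add: algebra_simps)
      also have "\<dots> \<le> real m * 0 + real n * (- d)"
        using f(2) f(3)[OF x(1)] g(3)[OF x(1)] by (intro add_mono mult_left_mono) auto
      finally show False using x(2) by simp
    qed
  qed
  moreover have "0 \<le> \<mu> a \<and> \<mu> a \<le> 1" for a using le_mu[OF T0] mu_le[of a 1] T1 by blast
  moreover have "\<delta> \<le> \<mu> c" if "c \<in> C" for c
  proof -
    have "(\<lambda>x. indicator c x - \<delta>) \<in> G0"
      unfolding G0_def using that by (intro CollectI exI[of _ "{#c#}"]) simp
    then show ?thesis using G(2) by (intro le_mu) (auto simp: T_def)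
  qed
  ultimately show ?thesis by blast
qed

section \<open>Intersection numbers\<close>

text \<open>The condition depends on \<open>x\<close> only through its incidence pattern. There are
  finitely many patterns, and the points with a given pattern form a finite intersection of sets
  \<open>b i\<close> and complements.\<close>

lemma (in algebra) sets_Collect_incidence:
  assumes "finite I" and b: "\<And>i. i \<in> I \<Longrightarrow> b i \<in> M"
  shows "{x \<in> \<Omega>. P {i \<in> I. x \<in> b i}} \<in> M"
proof -
  have pattern: "{x \<in> \<Omega>. x \<in> b i \<longleftrightarrow> i \<in> E} \<in> M" if "i \<in> I" for i E
  proof (cases "i \<in> E")
    case True
    then have "{x \<in> \<Omega>. x \<in> b i \<longleftrightarrow> i \<in> E} = \<Omega> \<inter> b i" by auto
    then show ?thesis using b[OF that] by auto
  next
    case False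
    then have "{x \<in> \<Omega>. x \<in> b i \<longleftrightarrow> i \<in> E} = \<Omega> - b i" by auto
    then show ?thesis using b[OF that] by auto
  qed
  have "{x \<in> \<Omega>. \<forall>i\<in>I. x \<in> b i \<longleftrightarrow> i \<in> E} \<in> M" for E
    using sets_Collect_neg[OF sets_Collect_finite_Ex[OF sets_Collect_neg[OF pattern] \<open>finite I\<close>]] by simp
  then have "(\<Union>E\<in>{E \<in> Pow I. P E}. {x \<in> \<Omega>. \<forall>i\<in>I. x \<in> b i \<longleftrightarrow> i \<in> E}) \<in> M"
    using \<open>finite I\<close> by (intro finite_UN) auto
  moreover have "{x \<in> \<Omega>. P {i \<in> I. x \<in> b i}} = (\<Union>E\<in>{E \<in> Pow I. P E}. {x \<in> \<Omega>. \<forall>i\<in>I. x \<in> b i \<longleftrightarrow> i \<in> E})"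
  proof (intro equalityI subsetI)
    fix x assume "x \<in> {x \<in> \<Omega>. P {i \<in> I. x \<in> b i}}"
    then show "x \<in> (\<Union>E\<in>{E \<in> Pow I. P E}. {x \<in> \<Omega>. \<forall>i\<in>I. x \<in> b i \<longleftrightarrow> i \<in> E})"
      by (intro UN_I[of "{i \<in> I. x \<in> b i}"]) auto
  next
    fix x assume "x \<in> (\<Union>E\<in>{E \<in> Pow I. P E}. {x \<in> \<Omega>. \<forall>i\<in>I. x \<in> b i \<longleftrightarrow> i \<in> E})"
    then obtain E where E: "E \<subseteq> I" "P E" "x \<in> \<Omega>" "\<forall>i\<in>I. x \<in> b i \<longleftrightarrow> i \<in> E" by auto
    then have "{i \<in> I. x \<in> b i} = E" by auto
    then show "x \<in> {x \<in> \<Omega>. P {i \<in> I. x \<in> b i}}" using E by simp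
  qed
  ultimately show ?thesis by simp
qed

text \<open>If no point lay in more than \<open>N\<close> members of the repeated family, an
  expander would match every incidence set into \<open>Y\<close>. The matchings cut each member into
  four pieces, one of which is in \<open>D\<close> by \<open>split\<close>. Chosen pieces attached
  to one vertex form an antichain, so each vertex carries at most \<open>r\<close> of them; but
  \<open>Y\<close> is too small for that.\<close>

lemma intersection_number_bound:
  fixes r :: nat
  assumes alg: "algebra X B" and "X \<noteq> {}" and "C \<subseteq> B" and "D \<subseteq> bpos B"
    and split: "\<And>f. (\<And>t. t < 4 \<Longrightarrow> f t \<in> B - D) \<Longrightarrow> (\<Union>t<4::nat. f t) \<notin> C"
    and chain: "\<And>A. antichain_in B A \<Longrightarrow> A \<subseteq> D \<Longrightarrow> card A \<le> r" and "0 < r"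
    and M: "set_mset M \<subseteq> C"
  shows "\<exists>x\<in>X. real (size M) \<le> 1296 * (real r)\<^sup>2 * (\<Sum>c\<in>#M. indicator c x)"
proof (cases "M = {#}")
  case True
  then show ?thesis using \<open>X \<noteq> {}\<close> by auto
next
  case False
  interpret algebra X B by (rule alg)
  obtain xs where xs: "mset xs = M" using ex_mset by blast
  define N where "N = length xs"
  define q where "q = 1296 * r\<^sup>2"
  \<comment> \<open>Repeating the family \<open>q\<close> times makes the size conditions of the expander exact.\<close>
  define I where "I = {..<N} \<times> {..<q}"
  define Y where "Y = {..<648 * r * N}"
  define b where "b p = xs ! fst p" for p :: "nat \<times> nat"
  define inc where "inc x = {p \<in> I. x \<in> b p}" for x
  have N: "N > 0" "size M = N" using False xs by (auto simp: N_def)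
  have cI: "card I = 1296 * r\<^sup>2 * N" by (simp add: I_def q_def card_cartesian_product)
  have fI: "finite I" by (simp add: I_def)
  have bC: "b p \<in> C" if "p \<in> I" for p
  proof -
    have "xs ! fst p \<in> set xs" using that by (auto simp: I_def N_def)
    then show ?thesis using M xs by (auto simp: b_def)
  qed
  have bB: "b p \<in> B" if "p \<in> I" for p using bC[OF that] \<open>C \<subseteq> B\<close> by auto
  have "\<exists>x\<in>X. N < card (inc x)"
  proof (rule ccontr)
    assume "\<not> ?thesis"
    then have few: "card (inc x) \<le> N" if "x \<in> X" for x using that by force
    obtain F where F: "F \<in> I \<times> {..<4::nat} \<rightarrow> Y"
      "\<And>E. E \<subseteq> I \<Longrightarrow> E \<noteq> {} \<Longrightarrow> card E \<le> N \<Longrightarrow> 2 * card E < card (F ` (E \<times> {..<4}))"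
    proof -
      have "\<exists>F \<in> I \<times> {..<4::nat} \<rightarrow> Y. \<forall>E \<subseteq> I. E \<noteq> {} \<longrightarrow> card E \<le> N \<longrightarrow> 2 * card E < card (F ` (E \<times> {..<4}))"
      proof (rule exists_expander[OF fI])
        \<comment> \<open>Equality holds here, because 324 * 1296 is the square of 648.\<close>
        show "324 * card I * N \<le> (card Y)\<^sup>2" by (simp add: cI Y_def power2_eq_square)
        have "2 * N \<le> 648 * r * N" using \<open>0 < r\<close> by (intro mult_right_mono) auto
        then show "2 * N \<le> card Y" by (simp add: Y_def)
      qed (use N \<open>0 < r\<close> in \<open>auto simp: Y_def\<close>)
      then show ?thesis using that by blast
    qed
    have "\<exists>f. (\<forall>p\<in>inc x. f p < 4) \<and> inj_on (\<lambda>p. F (p, f p)) (inc x)" if "x \<in> X" for x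
    proof (rule unique_neighbour_matching)
      show fin: "finite (inc x)" using fI by (simp add: inc_def)
      fix E assume E: "E \<subseteq> inc x" "E \<noteq> {}"
      then have "card E \<le> N" using few[OF that] card_mono[OF fin E(1)] by simp
      then show "2 * card E < card (F ` (E \<times> {..<4}))" using E by (intro F(2)) (auto simp: inc_def)
    qed
    then have "\<forall>E\<in>inc ` X. \<exists>f. (\<forall>p\<in>E. f p < 4) \<and> inj_on (\<lambda>p. F (p, f p)) E" by blast
    \<comment> \<open>The matching is chosen for the incidence set and not for the point, so that
      each piece is determined by finite incidence data and belongs to \<open>B\<close>.\<close>
    then obtain f where "\<forall>E\<in>inc ` X. (\<forall>p\<in>E. f E p < 4) \<and> inj_on (\<lambda>p. F (p, f E p)) E"
      by (rule bchoice[THEN exE])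
    then have f: "\<And>x p. x \<in> X \<Longrightarrow> p \<in> inc x \<Longrightarrow> f (inc x) p < 4"
      "\<And>x. x \<in> X \<Longrightarrow> inj_on (\<lambda>p. F (p, f (inc x) p)) (inc x)" by auto
    \<comment> \<open>Cut \<open>b p\<close> at each point by the edge used to match \<open>p\<close> there: pieces whose edges end in the
      same vertex are disjoint since the matching is injective.\<close>
    define piece where "piece p t = {x \<in> X. p \<in> inc x \<and> f (inc x) p = t}" for p t
    have piece_B: "piece p t \<in> B" for p t
      unfolding piece_def inc_def using fI bB by (intro sets_Collect_incidence) auto
    have "\<exists>t<4. piece p t \<in> D" if p: "p \<in> I" for p
    proof (rule ccontr)
      assume "\<not> ?thesis"
      then have "(\<Union>t<4. piece p t) \<notin> C" using piece_B by (intro split) auto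
      moreover have "(\<Union>t<4. piece p t) = b p"
        using f(1) p bB[OF p] sets_into_space by (fastforce simp: piece_def inc_def)
      ultimately show False using bC[OF p] by simp
    qed
    then obtain g where g: "\<And>p. p \<in> I \<Longrightarrow> g p < 4 \<and> piece p (g p) \<in> D" by metis
    define J where "J y = {p \<in> I. F (p, g p) = y}" for y
    have "card (J y) \<le> r" for y
    proof -
      define A where "A = (\<lambda>p. piece p (g p)) ` J y"
      have disj: "piece p (g p) \<inter> piece p' (g p') = {}" if "p \<in> J y" "p' \<in> J y" "p \<noteq> p'" for p p'
      proof (rule ccontr)
        assume "\<not> ?thesis"
        then obtain x where "x \<in> X" "p \<in> inc x" "f (inc x) p = g p" "p' \<in> inc x" "f (inc x) p' = g p'"
          by (auto simp: piece_def)
        then show False using f(2)[of x] that by (auto simp: J_def inj_on_def)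
      qed
      have ne: "piece p (g p) \<noteq> {}" "piece p (g p) \<in> D" if "p \<in> J y" for p
        using g[of p] that \<open>D \<subseteq> bpos B\<close> by (auto simp: J_def bpos_def)
      have "inj_on (\<lambda>p. piece p (g p)) (J y)"
        by (rule inj_onI) (metis disj ne(1) Int_absorb)
      then have "card A = card (J y)" unfolding A_def by (rule card_image)
      moreover have "antichain_in B A" "A \<subseteq> D"
        using disj ne \<open>D \<subseteq> bpos B\<close> unfolding antichain_in_def A_def by blast+
      ultimately show ?thesis using chain by metis
    qed
    \<comment> \<open>The sets \<open>J y\<close> partition \<open>I\<close>, which would give
      \<open>card I \<le> card Y * r\<close>; but \<open>card I\<close> is exactly twice that
      product.\<close>
    then have "(\<Sum>y\<in>Y. card (J y)) \<le> card Y * r" using sum_bounded_above[of Y "\<lambda>y. card (J y)" r] by simp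
    also have "(\<Sum>y\<in>Y. card (J y)) = card (\<Union>y\<in>Y. J y)"
      using fI by (intro card_UN_disjoint[symmetric]) (auto simp: Y_def J_def)
    also have "(\<Union>y\<in>Y. J y) = I" using F(1) g by (auto simp: J_def)
    finally have "1296 * r\<^sup>2 * N \<le> 648 * r * N * r" by (simp add: cI Y_def)
    then show False using N \<open>0 < r\<close> by (simp add: power2_eq_square)
  qed
  then obtain x where x: "x \<in> X" "N < card (inc x)" by blast
  have "inc x = {i. i < N \<and> x \<in> xs ! i} \<times> {..<q}" by (auto simp: inc_def I_def b_def)
  then have "card (inc x) = card {i. i < N \<and> x \<in> xs ! i} * q" by (simp add: card_cartesian_product)
  moreover have "(\<Sum>c\<in>#M. indicator c x :: real) = real (card {i. i < N \<and> x \<in> xs ! i})"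
  proof -
    have "(\<Sum>c\<in>#M. indicator c x :: real) = (\<Sum>c\<leftarrow>xs. indicator c x)"
      unfolding xs[symmetric] by (metis mset_map sum_mset_sum_list)
    also have "\<dots> = (\<Sum>i<N. indicator (xs ! i) x)"
      by (simp add: sum_list_sum_nth N_def atLeast0LessThan)
    also have "\<dots> = (\<Sum>i<N. if x \<in> xs ! i then 1 else 0)"
      by (intro sum.cong) (auto simp: indicator_def)
    also have "\<dots> = real (card {i. i < N \<and> x \<in> xs ! i})"
      by (subst sum.inter_filter[symmetric]) auto
    finally show ?thesis .
  qed
  ultimately have "1296 * (real r)\<^sup>2 * (\<Sum>c\<in>#M. indicator c x) = real (card (inc x))"
    by (simp add: q_def mult.commute)
  then show ?thesis using x N(2) by (intro bexI[of _ x]) auto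
qed

section \<open>Order convergence and charges\<close>

text \<open>For sequences in \<open>B\<close> this turns out to be \<open>blim B a {}\<close>.
  Stating it through a dominating sequence avoids iterated suprema and infima.\<close>

definition order_null :: "'a set set \<Rightarrow> (nat \<Rightarrow> 'a set) \<Rightarrow> bool" where
  "order_null B a \<longleftrightarrow> (\<exists>d. range d \<subseteq> B \<and> decseq d \<and> (\<forall>n. a n \<subseteq> d n) \<and>
     (\<forall>c\<in>B. (\<forall>n. c \<subseteq> d n) \<longrightarrow> c = {}))"

definition charge :: "'a set set \<Rightarrow> ('a set \<Rightarrow> real) \<Rightarrow> bool" where
  "charge B \<mu> \<longleftrightarrow> (\<forall>a\<in>B. 0 \<le> \<mu> a) \<and>
     (\<forall>a\<in>B. \<forall>b\<in>B. a \<inter> b = {} \<longrightarrow> \<mu> (a \<union> b) = \<mu> a + \<mu> b)"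

lemma order_nullI:
  assumes "range d \<subseteq> B" "decseq d" "\<And>n. a n \<subseteq> d n"
    and "\<And>c. c \<in> B \<Longrightarrow> (\<And>n. c \<subseteq> d n) \<Longrightarrow> c = {}"
  shows "order_null B a"
  using assms unfolding order_null_def by (intro exI[of _ d]) auto

lemma order_nullE:
  assumes "order_null B a"
  obtains d where "range d \<subseteq> B" "decseq d" "\<And>n. a n \<subseteq> d n"
    "\<And>c. c \<in> B \<Longrightarrow> (\<And>n. c \<subseteq> d n) \<Longrightarrow> c = {}"
  using assms unfolding order_null_def by auto

lemma order_null_subset: "order_null B a \<Longrightarrow> (\<And>n. b n \<subseteq> a n) \<Longrightarrow> order_null B b"
  unfolding order_null_def by (meson order_trans)

text \<open>Let \<open>c\<close> be below all \<open>d n \<union> e n\<close>. As both sequences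
  decrease, \<open>c - d m\<close> is below every \<open>e n\<close> for fixed \<open>m\<close>,
  hence empty; so \<open>c\<close> is below every \<open>d m\<close>.\<close>

lemma (in algebra) order_null_Un:
  assumes "order_null M a" "order_null M b"
  shows "order_null M (\<lambda>n. a n \<union> b n)"
proof -
  obtain d where d: "range d \<subseteq> M" "decseq d" "\<And>n. a n \<subseteq> d n"
    "\<And>c. c \<in> M \<Longrightarrow> (\<And>n. c \<subseteq> d n) \<Longrightarrow> c = {}" by (rule order_nullE[OF assms(1)]) blast
  obtain e where e: "range e \<subseteq> M" "decseq e" "\<And>n. b n \<subseteq> e n"
    "\<And>c. c \<in> M \<Longrightarrow> (\<And>n. c \<subseteq> e n) \<Longrightarrow> c = {}" by (rule order_nullE[OF assms(2)]) blast
  show ?thesis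
  proof (rule order_nullI[of "\<lambda>n. d n \<union> e n"])
    show "range (\<lambda>n. d n \<union> e n) \<subseteq> M" using d(1) e(1) by auto
    show "decseq (\<lambda>n. d n \<union> e n)" using d(2) e(2) unfolding decseq_def by blast
    show "a n \<union> b n \<subseteq> d n \<union> e n" for n using d(3)[of n] e(3)[of n] by blast
    fix c assume c: "c \<in> M" "\<And>n. c \<subseteq> d n \<union> e n"
    have "c - d m \<subseteq> e n" for m n
    proof -
      have "c \<subseteq> d (max m n) \<union> e (max m n)" by (rule c(2))
      also have "\<dots> \<subseteq> d m \<union> e n"
        using decseqD[OF d(2), of m "max m n"] decseqD[OF e(2), of n "max m n"] by auto
      finally show ?thesis by blast
    qed
    moreover have "c - d m \<in> M" for m using c(1) d(1) by auto
    ultimately have "c - d m = {}" for m using e(4) by blast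
    then show "c = {}" using d(4)[OF c(1)] by blast
  qed
qed

section \<open>Finitely additive functionals on an algebra of sets\<close>

context algebra
begin

lemma charge_nonneg: "charge M \<mu> \<Longrightarrow> a \<in> M \<Longrightarrow> 0 \<le> \<mu> a"
  by (simp add: charge_def)

lemma charge_Un: "charge M \<mu> \<Longrightarrow> a \<in> M \<Longrightarrow> b \<in> M \<Longrightarrow> a \<inter> b = {} \<Longrightarrow> \<mu> (a \<union> b) = \<mu> a + \<mu> b"
  by (simp add: charge_def)

lemma charge_empty: "charge M \<mu> \<Longrightarrow> \<mu> {} = 0"
  using charge_Un[of \<mu> "{}" "{}"] by simp

lemma charge_Diff: "charge M \<mu> \<Longrightarrow> a \<in> M \<Longrightarrow> b \<in> M \<Longrightarrow> a \<subseteq> b \<Longrightarrow> \<mu> (b - a) = \<mu> b - \<mu> a"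
  using charge_Un[of \<mu> a "b - a"] Diff[of b a] by (simp add: Un_absorb1)

lemma charge_mono: "charge M \<mu> \<Longrightarrow> a \<in> M \<Longrightarrow> b \<in> M \<Longrightarrow> a \<subseteq> b \<Longrightarrow> \<mu> a \<le> \<mu> b"
  using charge_Diff[of \<mu> a b] charge_nonneg[of \<mu> "b - a"] by auto

lemma charge_Un_le:
  assumes "charge M \<mu>" "a \<in> M" "b \<in> M"
  shows "\<mu> (a \<union> b) \<le> \<mu> a + \<mu> b"
proof -
  have "\<mu> (a \<union> b) = \<mu> a + \<mu> (b - a)"
    using charge_Un[OF assms(1,2), of "b - a"] assms by auto
  also have "\<mu> (b - a) \<le> \<mu> b" using assms by (intro charge_mono) auto
  finally show ?thesis by simp
qed

lemma charge_UN_le: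
  assumes "charge M \<mu>" "finite I" "\<And>i. i \<in> I \<Longrightarrow> a i \<in> M"
  shows "\<mu> (\<Union>i\<in>I. a i) \<le> (\<Sum>i\<in>I. \<mu> (a i))"
  using assms(2,3)
proof (induction I)
  case empty
  then show ?case using charge_empty[OF assms(1)] by simp
next
  case (insert i I)
  then show ?case using charge_Un_le[OF assms(1), of "a i" "\<Union>i\<in>I. a i"] by fastforce
qed

lemma charge_UN:
  assumes "charge M \<mu>" "finite I" "\<And>i. i \<in> I \<Longrightarrow> a i \<in> M" "disjoint_family_on a I"
  shows "\<mu> (\<Union>i\<in>I. a i) = (\<Sum>i\<in>I. \<mu> (a i))"
  using assms(2,3,4)
proof (induction I)
  case empty
  then show ?case using charge_empty[OF assms(1)] by simp
next
  case (insert i I)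
  have "a i \<inter> (\<Union>i\<in>I. a i) = {}" using insert by (auto simp: disjoint_family_on_def)
  moreover have "disjoint_family_on a I" using insert.prems(2) by (auto simp: disjoint_family_on_def)
  ultimately show ?case using charge_Un[OF assms(1), of "a i" "\<Union>i\<in>I. a i"] insert by auto
qed

end

section \<open>Countable suprema, infima and limits in \<open>B\<close>\<close>

locale boolean_sigma =
  fixes X :: "'a set" and B :: "'a set set"
  assumes boolean_sigma: "boolean_sigma_algebra X B"
begin

sublocale algebra X B
  using boolean_sigma by (simp add: boolean_sigma_algebra_def)

lemma space_nonempty: "X \<noteq> {}"
  using boolean_sigma by (simp add: boolean_sigma_algebra_def)

lemma bsup_in: "A \<subseteq> B \<Longrightarrow> countable A \<Longrightarrow> bsup B A \<in> B"
  using isLub_bsup[OF boolean_sigma] isLubD1a by metis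

lemma bsup_upper: "A \<subseteq> B \<Longrightarrow> countable A \<Longrightarrow> a \<in> A \<Longrightarrow> a \<subseteq> bsup B A"
  using isLub_bsup[OF boolean_sigma] isLubD2 by metis

lemma bsup_least: "A \<subseteq> B \<Longrightarrow> countable A \<Longrightarrow> u \<in> B \<Longrightarrow> (\<And>a. a \<in> A \<Longrightarrow> a \<subseteq> u) \<Longrightarrow> bsup B A \<subseteq> u"
  using isLub_le_isUb[OF isLub_bsup[OF boolean_sigma]] by (simp add: isUb_def setle_def)

lemma binf_in: "A \<subseteq> B \<Longrightarrow> countable A \<Longrightarrow> binf B A \<in> B"
  using isGlb_binf[OF boolean_sigma] isGlbD1a by metis

lemma binf_lower: "A \<subseteq> B \<Longrightarrow> countable A \<Longrightarrow> a \<in> A \<Longrightarrow> binf B A \<subseteq> a"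
  using isGlb_binf[OF boolean_sigma] isGlbD2 by metis

lemma binf_greatest: "A \<subseteq> B \<Longrightarrow> countable A \<Longrightarrow> u \<in> B \<Longrightarrow> (\<And>a. a \<in> A \<Longrightarrow> u \<subseteq> a) \<Longrightarrow> u \<subseteq> binf B A"
  using isGlb_le_isLb[OF isGlb_binf[OF boolean_sigma]] by (simp add: isLb_def setge_def)

text \<open>If the limit is zero, the tail suprema \<open>s\<close> are a dominating sequence.
  Conversely, \<open>d n\<close> lies above the tail supremum \<open>s n\<close>, and every tail
  infimum lies below every \<open>d m\<close> by comparison at the index \<open>max n m\<close>; so
  upper and lower limit both vanish.\<close>

lemma blim_empty_iff_order_null:
  assumes a: "range a \<subseteq> B"
  shows "blim B a {} \<longleftrightarrow> order_null B a"
proof -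
  define s where "s n = bsup B (a ` {n..})" for n
  have aB: "a ` {n..} \<subseteq> B" for n using a by auto
  have sB: "range s \<subseteq> B" unfolding s_def using bsup_in[OF aB] by auto
  have a_s: "a k \<subseteq> s n" if "n \<le> k" for n k
    unfolding s_def using that by (intro bsup_upper aB) auto
  have s_le: "s n \<subseteq> u" if "u \<in> B" "\<And>k. n \<le> k \<Longrightarrow> a k \<subseteq> u" for n u
    unfolding s_def using that by (intro bsup_least aB) auto
  have limsup: "blimsup B a = binf B (range s)" by (simp add: blimsup_def s_def)
  show ?thesis
  proof
    assume "blim B a {}"
    then have 0: "binf B (range s) = {}" by (simp add: blim_def limsup)
    show "order_null B a"
    proof (rule order_nullI[OF sB])
      show "decseq s" unfolding decseq_def using s_le a_s sB by (meson order_trans rangeI subsetD)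
      show "a n \<subseteq> s n" for n by (rule a_s) simp
      fix c assume "c \<in> B" "\<And>n. c \<subseteq> s n"
      then show "c = {}" using binf_greatest[OF sB, of c] 0 by auto
    qed
  next
    assume "order_null B a"
    then obtain d where d: "range d \<subseteq> B" "decseq d" "\<And>n. a n \<subseteq> d n"
      "\<And>c. c \<in> B \<Longrightarrow> (\<And>n. c \<subseteq> d n) \<Longrightarrow> c = {}" by (rule order_nullE) blast
    have a_d: "a k \<subseteq> d n" if "n \<le> k" for n k using d(3)[of k] decseqD[OF d(2) that] by auto
    have "s n \<subseteq> d n" for n using a_d d(1) by (intro s_le) auto
    then have "binf B (range s) \<subseteq> d n" for n
      using binf_lower[OF sB, of "s n"] by auto
    then have sup0: "blimsup B a = {}" unfolding limsup by (intro d(4) binf_in sB) auto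
    have "binf B (a ` {n..}) = {}" for n
    proof (rule d(4))
      show "binf B (a ` {n..}) \<in> B" by (intro binf_in aB) auto
      fix m
      have "binf B (a ` {n..}) \<subseteq> a (max n m)" by (intro binf_lower aB) auto
      also have "\<dots> \<subseteq> d m" by (rule a_d) simp
      finally show "binf B (a ` {n..}) \<subseteq> d m" .
    qed
    then have "bliminf B a = bsup B {{}}" by (simp add: bliminf_def)
    also have "\<dots> = {}" using bsup_least[of "{{}}" "{}"] by auto
    finally show "blim B a {}" using sup0 by (simp add: blim_def)
  qed
qed

end

section \<open>The countably additive part of a charge\<close>

context boolean_sigma
begin

definition exhausts :: "(nat \<Rightarrow> 'a set) \<Rightarrow> 'a set \<Rightarrow> bool" where
  "exhausts u a \<longleftrightarrow> range u \<subseteq> B \<and> incseq u \<and> (\<forall>c\<in>B. (\<forall>n. u n \<subseteq> c) \<longrightarrow> a \<subseteq> c)"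

lemma exhaustsI:
  assumes "\<And>n. u n \<in> B" "\<And>m n. m \<le> n \<Longrightarrow> u m \<subseteq> u n"
    and "\<And>c. c \<in> B \<Longrightarrow> (\<And>n. u n \<subseteq> c) \<Longrightarrow> a \<subseteq> c"
  shows "exhausts u a"
  unfolding exhausts_def incseq_def using assms by (simp add: image_subset_iff)

lemma exhausts_in: "exhausts u a \<Longrightarrow> u n \<in> B"
  by (auto simp: exhausts_def)

lemma exhausts_incseq: "exhausts u a \<Longrightarrow> m \<le> n \<Longrightarrow> u m \<subseteq> u n"
  by (simp add: exhausts_def incseqD)

lemma exhausts_least: "exhausts u a \<Longrightarrow> c \<in> B \<Longrightarrow> (\<And>n. u n \<subseteq> c) \<Longrightarrow> a \<subseteq> c"
  by (simp add: exhausts_def)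

lemma exhausts_subset: "exhausts u b \<Longrightarrow> a \<subseteq> b \<Longrightarrow> exhausts u a"
  unfolding exhausts_def by (meson order_trans)

lemma exhausts_const: "a \<in> B \<Longrightarrow> exhausts (\<lambda>_. a) a"
  by (rule exhaustsI) simp_all

text \<open>Distributivity: if \<open>c\<close> bounds the traces on \<open>b\<close>, then
  \<open>c \<union> (X - b)\<close> bounds \<open>u\<close> itself.\<close>

lemma exhausts_Int:
  assumes u: "exhausts u a" and b: "b \<in> B" "b \<subseteq> a"
  shows "exhausts (\<lambda>n. u n \<inter> b) b"
proof (rule exhaustsI)
  show "u n \<inter> b \<in> B" for n by (rule Int[OF exhausts_in[OF u] b(1)])
  show "u m \<inter> b \<subseteq> u n \<inter> b" if "m \<le> n" for m n
    by (rule Int_mono[OF exhausts_incseq[OF u that] subset_refl])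
  fix c assume c: "c \<in> B" "\<And>n. u n \<inter> b \<subseteq> c"
  have "u n \<subseteq> c \<union> (X - b)" for n
    using c(2)[of n] sets_into_space[OF exhausts_in[OF u, of n]] by blast
  then have "a \<subseteq> c \<union> (X - b)" by (rule exhausts_least[OF u Un[OF c(1) compl_sets[OF b(1)]]])
  then show "b \<subseteq> c" using b(2) by blast
qed

text \<open>Diagonal union: \<open>u i n\<close> is absorbed at stage \<open>max i n\<close>, so an
  upper bound of the diagonal sequence bounds every \<open>u i\<close>.\<close>

lemma exhausts_bsup:
  assumes a: "range a \<subseteq> B" and u: "\<And>i::nat. exhausts (u i) (a i)"
  shows "exhausts (\<lambda>n. \<Union>i\<le>n. u i n) (bsup B (range a))"
proof (rule exhaustsI)
  show "(\<Union>i\<le>n. u i n) \<in> B" for n using exhausts_in[OF u] by (intro finite_UN) auto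
  show "(\<Union>i\<le>m. u i m) \<subseteq> (\<Union>i\<le>n. u i n)" if "m \<le> n" for m n
    using that exhausts_incseq[OF u that] by (intro UN_mono) auto
  fix c assume c: "c \<in> B" "\<And>n. (\<Union>i\<le>n. u i n) \<subseteq> c"
  have "u i n \<subseteq> c" for i n
  proof -
    have "u i n \<subseteq> u i (max i n)" by (rule exhausts_incseq[OF u]) simp
    also have "\<dots> \<subseteq> (\<Union>j\<le>max i n. u j (max i n))" by (rule UN_upper) simp
    also have "\<dots> \<subseteq> c" by (rule c(2))
    finally show ?thesis .
  qed
  then have "a i \<subseteq> c" for i by (rule exhausts_least[OF u c(1)])
  then show "bsup B (range a) \<subseteq> c" using a c(1) by (intro bsup_least) auto
qed

lemma exhausts_Un:
  assumes u: "exhausts u a" and v: "exhausts v b"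
  shows "exhausts (\<lambda>n. u n \<union> v n) (a \<union> b)"
proof (rule exhaustsI)
  show "u n \<union> v n \<in> B" for n by (rule Un[OF exhausts_in[OF u] exhausts_in[OF v]])
  show "u m \<union> v m \<subseteq> u n \<union> v n" if "m \<le> n" for m n
    by (rule Un_mono[OF exhausts_incseq[OF u that] exhausts_incseq[OF v that]])
  fix c assume c: "c \<in> B" "\<And>n. u n \<union> v n \<subseteq> c"
  then show "a \<union> b \<subseteq> c" by (intro Un_least exhausts_least[OF u] exhausts_least[OF v]) auto
qed

text \<open>A set \<open>c\<close> below all the differences is disjoint from every
  \<open>u n\<close>; then \<open>X - c\<close> bounds \<open>u\<close> and contains
  \<open>a\<close>, although \<open>c\<close> is part of \<open>a\<close>.\<close>

lemma order_null_Diff_exhausts: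
  assumes u: "exhausts u a" and a: "a \<in> B"
  shows "order_null B (\<lambda>n. a - u n)"
proof (rule order_nullI)
  show "range (\<lambda>n. a - u n) \<subseteq> B" using Diff[OF a exhausts_in[OF u]] by auto
  show "decseq (\<lambda>n. a - u n)"
    unfolding decseq_def using exhausts_incseq[OF u] by (auto intro!: Diff_mono)
  fix c assume c: "c \<in> B" "\<And>n. c \<subseteq> a - u n"
  have "u n \<subseteq> X - c" for n using c(2)[of n] sets_into_space[OF exhausts_in[OF u, of n]] by blast
  then have "a \<subseteq> X - c" by (rule exhausts_least[OF u compl_sets[OF c(1)]])
  then show "c = {}" using c(2)[of 0] by blast
qed simp

text \<open>The countably additive part, as in the Yosida--Hewitt decomposition: the infimum of the
  limits of \<open>\<mu> (u n)\<close> over sequences exhausting \<open>a\<close>, with upper bounds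
  \<open>t\<close> in place of the limits.\<close>

definition regular_part :: "('a set \<Rightarrow> real) \<Rightarrow> 'a set \<Rightarrow> real" where
  "regular_part \<mu> a = Inf {t. \<exists>u. exhausts u a \<and> (\<forall>n. \<mu> (u n) \<le> t)}"

context
  fixes \<mu> :: "'a set \<Rightarrow> real"
  assumes \<mu>: "charge B \<mu>"
begin

lemma exhausts_bound_nonneg:
  assumes "exhausts u a" "\<And>n. \<mu> (u n) \<le> t"
  shows "0 \<le> t"
proof -
  have "u 0 \<in> B" by (rule exhausts_in[OF assms(1)])
  then show ?thesis using charge_nonneg[OF \<mu>] assms(2)[of 0] order_trans by blast
qed

lemma regular_part_le: 
  assumes "exhausts u a" "\<And>n. \<mu> (u n) \<le> t"
  shows "regular_part \<mu> a \<le> t"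
  unfolding regular_part_def
proof (rule cInf_lower)
  show "bdd_below {t. \<exists>u. exhausts u a \<and> (\<forall>n. \<mu> (u n) \<le> t)}"
    using exhausts_bound_nonneg by (intro bdd_belowI[of _ 0]) blast
qed (use assms in auto)

lemma regular_part_greatest:
  assumes "a \<in> B" "\<And>u t. exhausts u a \<Longrightarrow> (\<And>n. \<mu> (u n) \<le> t) \<Longrightarrow> s \<le> t"
  shows "s \<le> regular_part \<mu> a"
  unfolding regular_part_def using assms exhausts_const[OF assms(1)] by (intro cInf_greatest) auto

lemma regular_part_less:
  assumes "a \<in> B" "regular_part \<mu> a < s"
  obtains u where "exhausts u a" "\<And>n. \<mu> (u n) \<le> s"
proof -
  have "\<not> (\<forall>u t. exhausts u a \<longrightarrow> (\<forall>n. \<mu> (u n) \<le> t) \<longrightarrow> s \<le> t)"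
    using regular_part_greatest[OF assms(1), of s] assms(2) by auto
  then obtain u t where "exhausts u a" "\<forall>n. \<mu> (u n) \<le> t" "t < s" by (auto simp: not_le)
  then show ?thesis using that[of u] by (meson less_imp_le order_trans)
qed

lemma regular_part_nonneg: "a \<in> B \<Longrightarrow> 0 \<le> regular_part \<mu> a"
  using regular_part_greatest exhausts_bound_nonneg by meson

lemma regular_part_mono:
  assumes "a \<in> B" "b \<in> B" "a \<subseteq> b"
  shows "regular_part \<mu> a \<le> regular_part \<mu> b"
proof (rule regular_part_greatest[OF assms(2)])
  fix u t assume u: "exhausts u b" "\<And>n. \<mu> (u n) \<le> t"
  show "regular_part \<mu> a \<le> t"
    by (rule regular_part_le[OF exhausts_subset[OF u(1) assms(3)] u(2)])
qed

lemma regular_part_empty: "regular_part \<mu> {} = 0"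
proof (rule antisym)
  show "regular_part \<mu> {} \<le> 0"
    by (rule regular_part_le[OF exhausts_const]) (simp_all add: charge_empty[OF \<mu>])
qed (simp add: regular_part_nonneg)

text \<open>Uniting nearly optimal sequences for \<open>a\<close> and \<open>b\<close> gives
  subadditivity; cutting one sequence for \<open>a \<union> b\<close> into its traces on
  \<open>a\<close> and \<open>b\<close> gives superadditivity.\<close>

lemma charge_regular_part: "charge B (regular_part \<mu>)"
  unfolding charge_def
proof (intro conjI ballI impI)
  fix a b assume ab: "a \<in> B" "b \<in> B" "a \<inter> b = {}"
  show "regular_part \<mu> (a \<union> b) = regular_part \<mu> a + regular_part \<mu> b"
  proof (rule antisym)
    show "regular_part \<mu> (a \<union> b) \<le> regular_part \<mu> a + regular_part \<mu> b"
    proof (rule field_le_epsilon)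
      fix e :: real assume e: "e > 0"
      obtain u where u: "exhausts u a" "\<And>n. \<mu> (u n) \<le> regular_part \<mu> a + e / 2"
        using regular_part_less[OF ab(1), of "regular_part \<mu> a + e / 2"] e by auto
      obtain v where v: "exhausts v b" "\<And>n. \<mu> (v n) \<le> regular_part \<mu> b + e / 2"
        using regular_part_less[OF ab(2), of "regular_part \<mu> b + e / 2"] e by auto
      show "regular_part \<mu> (a \<union> b) \<le> regular_part \<mu> a + regular_part \<mu> b + e"
      proof (rule regular_part_le[OF exhausts_Un[OF u(1) v(1)]])
        fix n
        have "\<mu> (u n \<union> v n) \<le> \<mu> (u n) + \<mu> (v n)"
          by (rule charge_Un_le[OF \<mu> exhausts_in[OF u(1)] exhausts_in[OF v(1)]])
        then show "\<mu> (u n \<union> v n) \<le> regular_part \<mu> a + regular_part \<mu> b + e"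
          using u(2)[of n] v(2)[of n] by simp
      qed
    qed
    show "regular_part \<mu> a + regular_part \<mu> b \<le> regular_part \<mu> (a \<union> b)"
    proof (rule regular_part_greatest)
      fix u t assume u: "exhausts u (a \<union> b)" and t: "\<And>n. \<mu> (u n) \<le> t"
      note uB = exhausts_in[OF u]
      \<comment> \<open>With independent indices the infimum for \<open>a\<close> can be taken while
        \<open>n\<close> is fixed, and the one for \<open>b\<close> afterwards.\<close>
      have sum: "\<mu> (u m \<inter> a) + \<mu> (u n \<inter> b) \<le> t" for m n
      proof -
        let ?k = "max m n"
        have "u m \<subseteq> u ?k" "u n \<subseteq> u ?k" by (rule exhausts_incseq[OF u], simp)+
        then have "\<mu> (u m \<inter> a) + \<mu> (u n \<inter> b) \<le> \<mu> (u ?k \<inter> a) + \<mu> (u ?k \<inter> b)"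
          using uB ab by (intro add_mono charge_mono[OF \<mu>]) auto
        also have "\<dots> = \<mu> ((u ?k \<inter> a) \<union> (u ?k \<inter> b))"
          using uB ab by (intro charge_Un[OF \<mu>, symmetric]) auto
        also have "\<dots> \<le> \<mu> (u ?k)" using uB ab by (intro charge_mono[OF \<mu>]) auto
        finally show ?thesis using t[of ?k] by simp
      qed
      have "regular_part \<mu> a \<le> t - \<mu> (u n \<inter> b)" for n
        using sum[of _ n] by (intro regular_part_le[OF exhausts_Int[OF u ab(1)]]) (auto simp: le_diff_eq)
      then have "regular_part \<mu> b \<le> t - regular_part \<mu> a"
        by (intro regular_part_le[OF exhausts_Int[OF u ab(2)]]) (auto simp: le_diff_eq add.commute)
      then show "regular_part \<mu> a + regular_part \<mu> b \<le> t" by simp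
    qed (use ab in auto)
  qed
qed (rule regular_part_nonneg)

text \<open>Finite additivity and monotonicity bound the partial sums. For the other inequality,
  sequences exhausting \<open>a i\<close> with error \<open>e / 2 ^ (i + 1)\<close> are combined
  diagonally into one exhausting the supremum.\<close>

lemma regular_part_sums:
  assumes a: "range a \<subseteq> B" "disjoint_family a"
  shows "(\<lambda>n::nat. regular_part \<mu> (a n)) sums regular_part \<mu> (bsup B (range a))"
proof -
  define s where "s = bsup B (range a)"
  have aB: "a n \<in> B" for n using a(1) by auto
  have sB: "s \<in> B" unfolding s_def using a(1) by (intro bsup_in) auto
  have nn: "0 \<le> regular_part \<mu> (a n)" for n using aB by (rule regular_part_nonneg)
  have part: "(\<Sum>i<n. regular_part \<mu> (a i)) \<le> regular_part \<mu> s" for n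
  proof -
    have "(\<Sum>i<n. regular_part \<mu> (a i)) = regular_part \<mu> (\<Union>i<n. a i)"
      using aB a(2) by (intro charge_UN[OF charge_regular_part, symmetric])
        (auto simp: disjoint_family_on_def)
    also have "\<dots> \<le> regular_part \<mu> s"
    proof (rule regular_part_mono[OF _ sB])
      show "(\<Union>i<n. a i) \<in> B" using aB by auto
      have "a i \<subseteq> s" for i unfolding s_def using a(1) by (intro bsup_upper) auto
      then show "(\<Union>i<n. a i) \<subseteq> s" by blast
    qed
    finally show ?thesis .
  qed
  have summ: "summable (\<lambda>n. regular_part \<mu> (a n))"
    using nn part by (rule summableI_nonneg_bounded)
  have "regular_part \<mu> s \<le> (\<Sum>n. regular_part \<mu> (a n))"
  proof (rule field_le_epsilon)
    fix e :: real assume e: "e > 0"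
    define t where "t i = regular_part \<mu> (a i) + e * (1/2) ^ Suc i" for i
    have "\<exists>u. exhausts u (a i) \<and> (\<forall>n. \<mu> (u n) \<le> t i)" for i
    proof -
      have "regular_part \<mu> (a i) < t i" using e by (simp add: t_def)
      then show ?thesis by (rule regular_part_less[OF aB]) blast
    qed
    then obtain u where u: "\<And>i. exhausts (u i) (a i)" "\<And>i n. \<mu> (u i n) \<le> t i" by metis
    have "(\<lambda>i. e * (1/2::real) ^ Suc i) sums (e * 1)"
      by (intro sums_mult power_half_series)
    then have ts: "t sums ((\<Sum>n. regular_part \<mu> (a n)) + e)"
      unfolding t_def using sums_add[OF summable_sums[OF summ]] by simp
    have t0: "0 \<le> t i" for i using nn[of i] e by (simp add: t_def)
    show "regular_part \<mu> s \<le> (\<Sum>n. regular_part \<mu> (a n)) + e"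
      unfolding s_def
    proof (rule regular_part_le[OF exhausts_bsup[of a u]])
      fix n
      have "\<mu> (\<Union>i\<le>n. u i n) \<le> (\<Sum>i\<le>n. \<mu> (u i n))"
        by (intro charge_UN_le[OF \<mu>] exhausts_in[OF u(1)]) simp
      also have "\<dots> \<le> (\<Sum>i\<le>n. t i)" by (intro sum_mono u(2))
      also have "\<dots> \<le> (\<Sum>n. regular_part \<mu> (a n)) + e"
        using sum_le_suminf[OF sums_summable[OF ts], of "{..n}"] t0 sums_unique[OF ts] by simp
      finally show "\<mu> (\<Union>i\<le>n. u i n) \<le> (\<Sum>n. regular_part \<mu> (a n)) + e" .
    qed (use a(1) u(1) in auto)
  qed
  moreover have "(\<Sum>n. regular_part \<mu> (a n)) \<le> regular_part \<mu> s"
    using suminf_le_const[OF summ part] .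
  ultimately have "(\<Sum>n. regular_part \<mu> (a n)) = regular_part \<mu> s" by simp
  then show ?thesis using summable_sums[OF summ] by (simp add: s_def)
qed

end

lemma boolean_measure_regular_part:
  assumes "charge B \<mu>" and pos: "\<And>a. a \<in> B \<Longrightarrow> a \<noteq> {} \<Longrightarrow> 0 < regular_part \<mu> a"
  shows "boolean_measure X B (\<lambda>a. regular_part \<mu> a / regular_part \<mu> X)"
proof -
  have X: "0 < regular_part \<mu> X" using pos[of X] space_nonempty by auto
  show ?thesis
    unfolding boolean_measure_def
  proof (intro conjI ballI allI impI)
    show "regular_part \<mu> {} / regular_part \<mu> X = 0" by (simp add: regular_part_empty[OF assms(1)])
    show "regular_part \<mu> X / regular_part \<mu> X = 1" using X by simp
  next
    fix a b assume ab: "a \<in> B" "b \<in> B"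
    show "regular_part \<mu> a / regular_part \<mu> X \<le> regular_part \<mu> b / regular_part \<mu> X" if "a \<subseteq> b"
      using regular_part_mono[OF assms(1) ab that] X by (simp add: divide_right_mono)
    show "regular_part \<mu> (a \<union> b) / regular_part \<mu> X
        = regular_part \<mu> a / regular_part \<mu> X + regular_part \<mu> b / regular_part \<mu> X" if "a \<inter> b = {}"
      using charge_Un[OF charge_regular_part[OF assms(1)] ab that] by (simp add: add_divide_distrib)
  next
    show "0 < regular_part \<mu> a / regular_part \<mu> X" if "a \<in> B" "a \<noteq> {}" for a
      using pos[OF that] X by simp
  next
    fix a :: "nat \<Rightarrow> 'a set" assume "range a \<subseteq> B \<and> disjoint_family a"
    then show "(\<lambda>n. regular_part \<mu> (a n) / regular_part \<mu> X) sums (regular_part \<mu> (bsup B (range a)) / regular_part \<mu> X)"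
      using regular_part_sums[OF assms(1)] by (intro sums_divide) auto
  qed
qed

end

section \<open>From a family to a measure\<close>

locale controlling_family = boolean_sigma +
  fixes C :: "nat \<Rightarrow> 'a set set"
  assumes C_subset: "C n \<subseteq> bpos B"
    and C_cover: "bpos B \<subseteq> (\<Union>n. C n)"
    and C_up: "c \<in> C n \<Longrightarrow> b \<in> B \<Longrightarrow> c \<subseteq> b \<Longrightarrow> b \<in> C n"
    and C_antichain: "\<exists>K::nat. \<forall>A. antichain_in B A \<and> A \<subseteq> C n \<longrightarrow> finite A \<and> card A \<le> K"
    and C_small: "range a \<subseteq> B \<Longrightarrow> (\<And>n. a n \<notin> C n) \<Longrightarrow> order_null B a"
    and C_null: "range a \<subseteq> B \<Longrightarrow> order_null B a \<Longrightarrow> finite {n. a n \<in> C k}"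
begin

lemma empty_notin: "{} \<notin> C n"
  using C_subset by (auto simp: bpos_def)

lemma order_null_escapes:
  assumes "range a \<subseteq> B" "order_null B a"
  shows "\<exists>n. a n \<notin> C k"
  using ex_new_if_finite[OF infinite_UNIV_nat C_null[OF assms, of k]] by simp

text \<open>Otherwise counterexamples for each \<open>j\<close> give two sequences that are null by
  \<open>C_small\<close>, while all their unions stay in \<open>C k\<close>, contrary to
  \<open>C_null\<close>.\<close>

lemma halving: "\<exists>j. \<forall>a\<in>B. \<forall>b\<in>B. a \<notin> C j \<longrightarrow> b \<notin> C j \<longrightarrow> a \<union> b \<notin> C k"
proof (rule ccontr)
  assume "\<not> ?thesis"
  then have "\<forall>j. \<exists>a b. a \<in> B \<and> b \<in> B \<and> a \<notin> C j \<and> b \<notin> C j \<and> a \<union> b \<in> C k" by blast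
  then obtain a b where ab: "\<And>j. a j \<in> B" "\<And>j. b j \<in> B" "\<And>j. a j \<notin> C j" "\<And>j. b j \<notin> C j"
    "\<And>j. a j \<union> b j \<in> C k" by metis
  have "order_null B (\<lambda>j. a j \<union> b j)" using ab by (intro order_null_Un C_small) auto
  then show False using order_null_escapes[of "\<lambda>j. a j \<union> b j" k] ab by auto
qed

definition half :: "nat \<Rightarrow> nat" where
  "half k = (SOME j. \<forall>a\<in>B. \<forall>b\<in>B. a \<notin> C j \<longrightarrow> b \<notin> C j \<longrightarrow> a \<union> b \<notin> C k)"

lemma half_Un: "a \<in> B \<Longrightarrow> b \<in> B \<Longrightarrow> a \<notin> C (half k) \<Longrightarrow> b \<notin> C (half k) \<Longrightarrow> a \<union> b \<notin> C k"
  using someI_ex[OF halving[of k]] unfolding half_def by blast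

text \<open>The iterates of \<open>half\<close> play the role of the errors
  \<open>e / 2 ^ (i + 1)\<close>. The induction splits off the first set, which is why the starting
  index \<open>j\<close> is kept general.\<close>

lemma half_UN:
  assumes "\<And>i. d i \<in> B" "\<And>i. d i \<notin> C ((half ^^ Suc i) k)"
  shows "(\<Union>i<m. d i) \<notin> C k"
proof -
  have "(\<Union>i<m. d (j + i)) \<notin> C ((half ^^ j) k)" for j
  proof (induction m arbitrary: j)
    case 0
    then show ?case using empty_notin by simp
  next
    case (Suc m)
    have "d j \<union> (\<Union>i<m. d (Suc j + i)) \<notin> C ((half ^^ j) k)"
    proof (rule half_Un)
      show "d j \<notin> C (half ((half ^^ j) k))" using assms(2)[of j] by simp
      show "(\<Union>i<m. d (Suc j + i)) \<notin> C (half ((half ^^ j) k))" using Suc[of "Suc j"] by simp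
    qed (use assms(1) in auto)
    moreover have "(\<Union>i<Suc m. d (j + i)) = d j \<union> (\<Union>i<m. d (Suc j + i))"
      by (simp add: lessThan_Suc_eq_insert_0)
    ultimately show ?case by simp
  qed
  from this[of 0] show ?thesis by simp
qed

text \<open>If the regular part vanished at \<open>a\<close>, there would be \<open>w i\<close>
  inside \<open>a\<close> of charge at most \<open>(1/2) ^ i\<close> with \<open>a - w i\<close>
  outside ever deeper levels. What remains of \<open>a\<close> after removing these differences
  decreases to zero, since \<open>\<mu>\<close> is strictly positive. One level of
  \<open>half\<close> covers the removed sets and the remainder, putting \<open>a\<close> outside
  \<open>C k\<close>.\<close>

lemma regular_part_pos:
  assumes \<mu>: "charge B \<mu>" and pos: "\<And>a. a \<in> B \<Longrightarrow> a \<noteq> {} \<Longrightarrow> 0 < \<mu> a"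
    and a: "a \<in> B" "a \<noteq> {}"
  shows "0 < regular_part \<mu> a"
proof (rule ccontr)
  assume "\<not> ?thesis"
  then have zero: "regular_part \<mu> a = 0" using regular_part_nonneg[OF \<mu> a(1)] by simp
  have "a \<in> bpos B" using a by (simp add: bpos_def)
  then obtain k where k: "a \<in> C k" using C_cover by blast
  have "\<exists>w\<in>B. w \<subseteq> a \<and> \<mu> w \<le> (1/2) ^ i \<and> a - w \<notin> C ((half ^^ Suc i) (half k))" for i
  proof -
    obtain u where u: "exhausts u a" "\<And>n. \<mu> (u n) \<le> (1/2) ^ i"
      using regular_part_less[OF \<mu> a(1), of "(1/2) ^ i"] zero by auto
    note uB = exhausts_in[OF u(1)]
    obtain n where "a - u n \<notin> C ((half ^^ Suc i) (half k))"
      using order_null_escapes[OF _ order_null_Diff_exhausts[OF u(1) a(1)]] uB a by blast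
    moreover have "a - u n \<inter> a = a - u n" by auto
    moreover have "\<mu> (u n \<inter> a) \<le> \<mu> (u n)" using uB a by (intro charge_mono[OF \<mu>]) auto
    ultimately show ?thesis using u(2)[of n] uB a by (intro bexI[of _ "u n \<inter> a"]) auto
  qed
  then obtain w where w: "\<And>i. w i \<in> B" "\<And>i. w i \<subseteq> a" "\<And>i. \<mu> (w i) \<le> (1/2) ^ i"
    "\<And>i. a - w i \<notin> C ((half ^^ Suc i) (half k))" by metis
  define b where "b m = a - (\<Union>i<m. a - w i)" for m
  have UB: "(\<Union>i<m. a - w i) \<in> B" for m using a(1) w(1) by (intro finite_UN) auto
  have bB: "b m \<in> B" for m unfolding b_def by (rule Diff[OF a(1) UB])
  have "order_null B b"
  proof (rule order_nullI[of b])
    show "range b \<subseteq> B" using bB by auto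
    show "decseq b" unfolding decseq_def b_def by auto
    fix c assume c: "c \<in> B" "\<And>n. c \<subseteq> b n"
    \<comment> \<open>In \<open>b (Suc i)\<close> the difference \<open>a - w i\<close> has already
      been removed.\<close>
    have "c \<subseteq> w i" for i using c(2)[of "Suc i"] by (auto simp: b_def)
    then have le: "\<mu> c \<le> (1/2) ^ i" for i using charge_mono[OF \<mu> c(1) w(1)] w(3) order_trans by blast
    have "\<mu> c \<le> 0" using LIMSEQ_le_const[OF LIMSEQ_power_zero[of "1/2::real"]] le by auto
    then show "c = {}" using pos[OF c(1)] by force
  qed simp
  then obtain m where m: "b m \<notin> C (half k)" using order_null_escapes[of b] bB by blast
  have "(\<Union>i<m. a - w i) \<notin> C (half k)" using w a by (intro half_UN) auto
  then have "b m \<union> (\<Union>i<m. a - w i) \<notin> C k" by (rule half_Un[OF bB UB m])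
  moreover have "b m \<union> (\<Union>i<m. a - w i) = a" by (auto simp: b_def)
  ultimately show False using k by simp
qed

end

section \<open>A strictly positive charge from the antichain bounds\<close>

context controlling_family
begin

lemma exists_charge_on_level:
  "\<exists>\<mu>. charge B \<mu> \<and> (\<forall>a. \<mu> a \<le> 1) \<and> (\<forall>c\<in>C n. 0 < \<mu> c)"
proof -
  \<comment> \<open>Two halvings suffice for the union of four pieces.\<close>
  let ?D = "C (half (half n))"
  obtain K :: nat where K: "\<And>A. antichain_in B A \<Longrightarrow> A \<subseteq> ?D \<Longrightarrow> finite A \<and> card A \<le> K"
    using C_antichain by blast
  \<comment> \<open>The successor keeps \<open>r\<close> positive even if \<open>K\<close> is
    zero.\<close>
  define r where "r = Suc K"
  define \<delta> :: real where "\<delta> = 1 / (1296 * (real r)\<^sup>2)"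
  have \<delta>: "\<delta> > 0" by (simp add: \<delta>_def r_def)
  have CB: "C n \<subseteq> B" using C_subset by (auto simp: bpos_def)
  have "\<exists>x\<in>X. \<delta> * real (size M) \<le> (\<Sum>c\<in>#M. indicator c x)" if M: "set_mset M \<subseteq> C n" for M
  proof -
    have "\<exists>x\<in>X. real (size M) \<le> 1296 * (real r)\<^sup>2 * (\<Sum>c\<in>#M. indicator c x)"
    proof (rule intersection_number_bound[OF algebra_axioms space_nonempty CB C_subset _ _ _ M])
      fix f :: "nat \<Rightarrow> 'a set" assume f: "\<And>t. t < 4 \<Longrightarrow> f t \<in> B - ?D"
      have "(f 0 \<union> f 1) \<union> (f 2 \<union> f 3) \<notin> C n" using f by (intro half_Un Un) auto
      moreover have "(\<Union>t<4::nat. f t) = (f 0 \<union> f 1) \<union> (f 2 \<union> f 3)"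
        by (auto simp: eval_nat_numeral lessThan_Suc)
      ultimately show "(\<Union>t<4::nat. f t) \<notin> C n" by simp
    next
      show "card A \<le> r" if "antichain_in B A" "A \<subseteq> ?D" for A
        using K[OF that] by (simp add: r_def)
    qed (simp add: r_def)
    then show ?thesis by (auto simp: \<delta>_def r_def field_simps)
  qed
  from exists_charge_of_intersection_number[OF space_nonempty this]
  obtain \<mu> :: "'a set \<Rightarrow> real" where "\<forall>a. 0 \<le> \<mu> a \<and> \<mu> a \<le> 1"
    "\<forall>a b. a \<inter> b = {} \<longrightarrow> \<mu> (a \<union> b) = \<mu> a + \<mu> b" "\<forall>c\<in>C n. \<delta> \<le> \<mu> c" by blast
  then show ?thesis using \<delta> by (intro exI[of _ \<mu>]) (force simp: charge_def)
qed

lemma exists_strictly_positive_charge: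
  "\<exists>\<mu>. charge B \<mu> \<and> (\<forall>a\<in>B. a \<noteq> {} \<longrightarrow> 0 < \<mu> a)"
proof -
  obtain \<nu> where \<nu>: "\<And>n. charge B (\<nu> n)" "\<And>n a. \<nu> n a \<le> 1" "\<And>n c. c \<in> C n \<Longrightarrow> 0 < \<nu> n c"
    using exists_charge_on_level by metis
  define \<mu> where "\<mu> a = (\<Sum>n. (1/2) ^ n * \<nu> n a)" for a
  have nn: "0 \<le> (1/2) ^ n * \<nu> n a" if "a \<in> B" for n a
    using charge_nonneg[OF \<nu>(1) that] by simp
  have summ: "summable (\<lambda>n. (1/2) ^ n * \<nu> n a)" if "a \<in> B" for a
  proof (rule summable_comparison_test)
    show "\<exists>N. \<forall>n\<ge>N. norm ((1/2) ^ n * \<nu> n a) \<le> (1/2) ^ n"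
      using nn[OF that] \<nu>(2)[of _ a] by (auto simp: mult_left_le)
  qed (simp add: summable_geometric)
  have "charge B \<mu>"
    unfolding charge_def
  proof (intro conjI ballI impI)
    show "0 \<le> \<mu> a" if "a \<in> B" for a
      unfolding \<mu>_def using nn[OF that] by (intro suminf_nonneg summ that)
    fix a b assume ab: "a \<in> B" "b \<in> B" "a \<inter> b = {}"
    show "\<mu> (a \<union> b) = \<mu> a + \<mu> b"
      unfolding \<mu>_def suminf_add[OF summ[OF ab(1)] summ[OF ab(2)]]
      by (simp add: charge_Un[OF \<nu>(1) ab] distrib_left)
  qed
  moreover have "0 < \<mu> a" if "a \<in> B" "a \<noteq> {}" for a
  proof -
    have "a \<in> bpos B" using that by (simp add: bpos_def)
    then obtain n where n: "a \<in> C n" using C_cover by blast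
    show ?thesis
      unfolding \<mu>_def using nn[OF that(1)] \<nu>(3)[OF n]
      by (intro suminf_pos2[OF summ[OF that(1)], of n]) auto
  qed
  ultimately show ?thesis by blast
qed

lemma exists_boolean_measure: "\<exists>m. boolean_measure X B m"
  using exists_strictly_positive_charge boolean_measure_regular_part regular_part_pos by metis

end

section \<open>From a measure to its levels\<close>

locale boolean_measured = boolean_sigma +
  fixes m :: "'a set \<Rightarrow> real"
  assumes measure: "boolean_measure X B m"
begin

lemma charge: "charge B m"
proof -
  have "m {} = 0" and "\<And>a. a \<in> B \<Longrightarrow> a \<noteq> {} \<Longrightarrow> m a > 0"
    using measure by (auto simp: boolean_measure_def)
  then have "0 \<le> m a" if "a \<in> B" for a using that by (cases "a = {}") (auto simp: less_imp_le)
  then show ?thesis using measure by (auto simp: charge_def boolean_measure_def)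
qed

lemma measure_pos: "a \<in> B \<Longrightarrow> a \<noteq> {} \<Longrightarrow> 0 < m a"
  using measure by (simp add: boolean_measure_def)

lemma measure_sums: "range a \<subseteq> B \<Longrightarrow> disjoint_family a \<Longrightarrow> (\<lambda>n::nat. m (a n)) sums m (bsup B (range a))"
  using measure by (simp add: boolean_measure_def)

text \<open>Countable subadditivity. The disjointed sequence covers the same points, so its supremum
  in \<open>B\<close> dominates every \<open>a n\<close>, and countable additivity applies to
  it.\<close>

lemma measure_bsup_le:
  fixes a :: "nat \<Rightarrow> 'a set"
  assumes a: "range a \<subseteq> B" and t: "\<And>n. m (a n) \<le> t n" "t sums T"
  shows "m (bsup B (range a)) \<le> T"
proof -
  have D: "range (disjointed a) \<subseteq> B" using a by (rule range_disjointed_sets)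
  have "a n \<subseteq> bsup B (range (disjointed a))" for n
  proof -
    have "a n \<subseteq> (\<Union>i. disjointed a i)" unfolding UN_disjointed_eq by auto
    also have "\<dots> \<subseteq> bsup B (range (disjointed a))" using D by (intro UN_least bsup_upper) auto
    finally show ?thesis .
  qed
  then have "bsup B (range a) \<subseteq> bsup B (range (disjointed a))"
    using a D by (intro bsup_least bsup_in) auto
  then have "m (bsup B (range a)) \<le> m (bsup B (range (disjointed a)))"
    using a D by (intro charge_mono[OF charge] bsup_in) auto
  also have "\<dots> \<le> T"
  proof (rule sums_le)
    show "(\<lambda>n. m (disjointed a n)) sums m (bsup B (range (disjointed a)))"
      using D by (intro measure_sums disjoint_family_disjointed)
    show "m (disjointed a n) \<le> t n" for n
      using a D by (intro order_trans[OF charge_mono[OF charge] t(1)] disjointed_subset) auto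
  qed (rule t(2))
  finally show ?thesis .
qed

text \<open>Borel--Cantelli: the tail suprema \<open>s n\<close> have measure at most
  \<open>2 * (1/2) ^ n\<close>, so an element below all of them has measure zero and is
  empty.\<close>

lemma order_null_of_measure_less:
  assumes a: "range a \<subseteq> B" and small: "\<And>n. m (a n) \<le> (1/2) ^ n"
  shows "order_null B a"
proof -
  define s where "s n = bsup B (range (\<lambda>k. a (n + k)))" for n
  have aB: "range (\<lambda>k. a (n + k)) \<subseteq> B" for n using a by auto
  have sB: "s n \<in> B" for n unfolding s_def using aB by (intro bsup_in) auto
  have a_s: "a k \<subseteq> s n" if "n \<le> k" for n k
    unfolding s_def using that by (intro bsup_upper aB) (auto intro: image_eqI[of _ _ "k - n"])
  have ms: "m (s n) \<le> (1/2) ^ n * 2" for n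
    unfolding s_def
  proof (rule measure_bsup_le[OF aB])
    show "m (a (n + k)) \<le> (1/2) ^ n * (1/2) ^ k" for k using small[of "n + k"] by (simp add: power_add)
    show "(\<lambda>k. (1/2) ^ n * (1/2::real) ^ k) sums ((1/2) ^ n * 2)"
      using geometric_sums[of "1/2::real"] by (intro sums_mult) simp
  qed
  show ?thesis
  proof (rule order_nullI[of s])
    show "range s \<subseteq> B" using sB by auto
    show "decseq s"
      unfolding decseq_def
    proof (intro allI impI)
      fix i j :: nat assume ij: "i \<le> j"
      have "a (j + k) \<subseteq> s i" for k using ij by (intro a_s) simp
      then show "s j \<subseteq> s i" unfolding s_def[of j] by (intro bsup_least aB sB) auto
    qed
    show "a n \<subseteq> s n" for n by (rule a_s) simp
    fix c assume c: "c \<in> B" "\<And>n. c \<subseteq> s n"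
    have le: "m c \<le> (1/2) ^ n * 2" for n using charge_mono[OF charge c(1) sB c(2)] ms order_trans by blast
    have "(\<lambda>n. (1/2::real) ^ n * 2) \<longlonglongrightarrow> 0 * 2" by (intro tendsto_mult LIMSEQ_power_zero tendsto_const) simp
    then have "m c \<le> 0" using LIMSEQ_le_const le by fastforce
    then show "c = {}" using measure_pos[OF c(1)] by force
  qed
qed

text \<open>Continuity from above: the disjoint differences \<open>e n\<close> have supremum
  \<open>d 0\<close>, because what they miss of \<open>d 0\<close> lies below every
  \<open>d n\<close>. Their measures telescope.\<close>

lemma measure_tendsto_zero:
  assumes "order_null B a" and a: "range a \<subseteq> B"
  shows "(\<lambda>n. m (a n)) \<longlonglongrightarrow> 0"
proof -
  obtain d where d: "range d \<subseteq> B" "decseq d" "\<And>n. a n \<subseteq> d n"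
    "\<And>c. c \<in> B \<Longrightarrow> (\<And>n. c \<subseteq> d n) \<Longrightarrow> c = {}" by (rule order_nullE[OF assms(1)]) blast
  define e where "e n = d n - d (Suc n)" for n
  have dB: "d n \<in> B" for n using d(1) by auto
  have eB: "range e \<subseteq> B" unfolding e_def using dB by auto
  have dec: "d (Suc n) \<subseteq> d n" for n using decseqD[OF d(2), of n "Suc n"] by simp
  have me: "m (e n) = m (d n) - m (d (Suc n))" for n
    unfolding e_def by (rule charge_Diff[OF charge dB dB dec])
  have disj: "e i \<inter> e j = {}" if "i < j" for i j
    using decseqD[OF d(2), of "Suc i" j] that by (auto simp: e_def)
  have "disjoint_family e"
    unfolding disjoint_family_on_def using disj by (metis Int_commute linorder_neqE_nat)
  then have "(\<lambda>n. m (e n)) sums m (bsup B (range e))" by (intro measure_sums eB)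
  moreover have "bsup B (range e) = d 0"
  proof
    have "e n \<subseteq> d 0" for n using decseqD[OF d(2), of 0 n] by (auto simp: e_def)
    then show "bsup B (range e) \<subseteq> d 0" using eB dB by (intro bsup_least) auto
    have sB: "bsup B (range e) \<in> B" using eB by (intro bsup_in) auto
    have up: "e n \<subseteq> bsup B (range e)" for n using eB by (intro bsup_upper) auto
    have "d 0 - bsup B (range e) \<subseteq> d n" for n
    proof (induction n)
      case (Suc n)
      then show ?case using up[of n] by (auto simp: e_def)
    qed auto
    then have "d 0 - bsup B (range e) = {}" using dB sB by (intro d(4)) auto
    then show "d 0 \<subseteq> bsup B (range e)" by blast
  qed
  moreover have "(\<Sum>i<n. m (e i)) = m (d 0) - m (d n)" for n by (induction n) (simp_all add: me)
  ultimately have "(\<lambda>n. m (d 0) - m (d n)) \<longlonglongrightarrow> m (d 0)" by (simp add: sums_def)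
  then have "(\<lambda>n. m (d 0) - (m (d 0) - m (d n))) \<longlonglongrightarrow> m (d 0) - m (d 0)"
    by (intro tendsto_diff tendsto_const)
  then have "(\<lambda>n. m (d n)) \<longlonglongrightarrow> 0" by simp
  then show ?thesis
  proof (rule tendsto_sandwich[rotated 3])
    show "\<forall>\<^sub>F n in sequentially. 0 \<le> m (a n)"
      using charge_nonneg[OF charge] a by (intro always_eventually) auto
    show "\<forall>\<^sub>F n in sequentially. m (a n) \<le> m (d n)"
      using charge_mono[OF charge _ dB d(3)] a by (intro always_eventually) auto
  qed (rule tendsto_const)
qed

definition level :: "nat \<Rightarrow> 'a set set" where
  "level n = {a \<in> B. (1/2) ^ n \<le> m a}"

lemma level_subset: "level n \<subseteq> bpos B"
proof -
  have "m {} = 0" by (rule charge_empty[OF charge])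
  moreover have "\<not> (1/2::real) ^ n \<le> 0" by (simp add: not_le)
  ultimately show ?thesis by (auto simp: level_def bpos_def)
qed

lemma bpos_eq_levels: "bpos B = (\<Union>n. level n)"
proof
  show "bpos B \<subseteq> (\<Union>n. level n)"
  proof
    fix a assume "a \<in> bpos B"
    then have a: "a \<in> B" "0 < m a" using measure_pos by (auto simp: bpos_def)
    obtain n where "(1/2) ^ n < m a" using real_arch_pow_inv[OF a(2), of "1/2"] by auto
    then show "a \<in> (\<Union>n. level n)" using a by (auto simp: level_def intro!: exI[of _ n])
  qed
qed (use level_subset in blast)

text \<open>Disjoint elements of measure at least \<open>(1/2) ^ n\<close> have total measure at
  most 1; the bound on finite subfamilies also forces finiteness.\<close>

lemma antichain_level:
  assumes A: "antichain_in B A" "A \<subseteq> level n"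
  shows "finite A \<and> card A \<le> 2 ^ n"
proof -
  have fin: "card F \<le> 2 ^ n" if F: "F \<subseteq> A" "finite F" for F
  proof -
    have FB: "a \<in> B" "(1/2) ^ n \<le> m a" if "a \<in> F" for a using F A that by (auto simp: level_def)
    have "real (card F) * (1/2) ^ n \<le> (\<Sum>a\<in>F. m a)"
      using FB by (intro sum_bounded_below) auto
    also have "\<dots> = m (\<Union>a\<in>F. a)"
    proof (rule charge_UN[OF charge F(2) FB(1), symmetric])
      show "disjoint_family_on (\<lambda>a. a) F"
        using F(1) A(1) unfolding disjoint_family_on_def antichain_in_def by blast
    qed
    also have "\<dots> \<le> m X"
      using F(2) FB sets_into_space by (intro charge_mono[OF charge] finite_UN) auto
    also have "\<dots> = 1" using measure by (simp add: boolean_measure_def)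
    finally have "real (card F) \<le> 2 ^ n" by (simp add: power_one_over field_simps)
    then have "real (card F) \<le> real (2 ^ n)" by simp
    then show ?thesis by (simp only: of_nat_le_iff)
  qed
  have "finite A"
  proof (rule ccontr)
    assume "infinite A"
    then obtain F where "F \<subseteq> A" "finite F" "card F = Suc (2 ^ n)" using infinite_arbitrarily_large by metis
    then show False using fin[of F] by simp
  qed
  then show ?thesis using fin by blast
qed

lemma blim_empty_of_notin_level:
  assumes a: "range a \<subseteq> B" "\<And>n. a n \<notin> level n"
  shows "blim B a {}"
  unfolding blim_empty_iff_order_null[OF a(1)]
proof (rule order_null_of_measure_less[OF a(1)])
  show "m (a n) \<le> (1/2) ^ n" for n using a(1) a(2)[of n] by (auto simp: level_def)
qed

lemma finite_level_of_blim_empty: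
  assumes a: "range a \<subseteq> B" "blim B a {}"
  shows "finite {n. a n \<in> level k}"
proof -
  have "order_null B a" using a by (simp add: blim_empty_iff_order_null)
  then have "\<forall>\<^sub>F n in sequentially. m (a n) < (1/2) ^ k"
    by (intro order_tendstoD(2)[OF measure_tendsto_zero] a(1)) simp_all
  then obtain N where N: "\<And>n. n \<ge> N \<Longrightarrow> m (a n) < (1/2) ^ k" by (auto simp: eventually_sequentially)
  have "{n. a n \<in> level k} \<subseteq> {..<N}"
    using N by (force simp: level_def not_less[symmetric])
  then show ?thesis by (rule finite_subset) simp
qed

end

section \<open>Passage to upward closures and the equivalence\<close>

text \<open>The hypotheses pass to the upward closures \<open>U n\<close>: choosing below each
  element of an antichain in \<open>U n\<close> a member of \<open>C n\<close> gives an antichain of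
  the same size.\<close>

lemma (in boolean_sigma) exists_boolean_measure_of_family:
  fixes C :: "nat \<Rightarrow> 'a set set"
  assumes C: "\<And>n. C n \<subseteq> bpos B" "bpos B = (\<Union>n. C n)"
      "\<And>n. \<exists>K::nat. \<forall>A. antichain_in B A \<and> A \<subseteq> C n \<longrightarrow> finite A \<and> card A \<le> K"
    and small: "\<And>a. range a \<subseteq> B \<Longrightarrow> (\<And>n. a n \<notin> C n) \<Longrightarrow> blim B a {}"
    and null: "\<And>a k. range a \<subseteq> B \<Longrightarrow> blim B a {} \<Longrightarrow> finite {n. a n \<in> C k}"
  shows "\<exists>m. boolean_measure X B m"
proof -
  note null_iff = blim_empty_iff_order_null
  define U where "U n = {b \<in> B. \<exists>c\<in>C n. c \<subseteq> b}" for n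
  have CB: "c \<in> B" "c \<noteq> {}" if "c \<in> C n" for c n
    using C(1)[of n] that by (auto simp: bpos_def)
  have U: "C n \<subseteq> U n" for n using CB by (auto simp: U_def)
  interpret controlling_family X B U
  proof
    show "U n \<subseteq> bpos B" for n using CB(2) by (auto simp: U_def bpos_def)
    show "bpos B \<subseteq> (\<Union>n. U n)" unfolding C(2) using U by blast
    show "b \<in> U n" if "c \<in> U n" "b \<in> B" "c \<subseteq> b" for b c n using that by (auto simp: U_def)
    show "\<exists>K::nat. \<forall>A. antichain_in B A \<and> A \<subseteq> U n \<longrightarrow> finite A \<and> card A \<le> K" for n
    proof -
      obtain K :: nat where K: "\<And>A. antichain_in B A \<Longrightarrow> A \<subseteq> C n \<Longrightarrow> finite A \<and> card A \<le> K"
        using C(3)[of n] by blast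
      have "finite A \<and> card A \<le> K" if A: "antichain_in B A" "A \<subseteq> U n" for A
      proof -
        have "\<forall>b\<in>A. \<exists>c. c \<in> C n \<and> c \<subseteq> b" using A by (auto simp: U_def)
        then obtain f where f: "\<And>b. b \<in> A \<Longrightarrow> f b \<in> C n \<and> f b \<subseteq> b" by metis
        have fpos: "f b \<in> bpos B" if "b \<in> A" for b using f[OF that] C(1) by blast
        have disj: "f b \<inter> f b' = {}" if "b \<in> A" "b' \<in> A" "b \<noteq> b'" for b b'
        proof -
          have "b \<inter> b' = {}" using A(1) that by (simp add: antichain_in_def)
          then show ?thesis using f[OF that(1)] f[OF that(2)] by blast
        qed
        have "inj_on f A"
          by (rule inj_onI) (metis disj f CB(2) Int_absorb)
        moreover have "antichain_in B (f ` A)"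
          unfolding antichain_in_def using fpos disj by fastforce
        then have "finite (f ` A) \<and> card (f ` A) \<le> K" using f by (intro K) auto
        ultimately show ?thesis by (simp add: finite_image_iff card_image)
      qed
      then show ?thesis by blast
    qed
    show "order_null B a" if "range a \<subseteq> B" "\<And>n. a n \<notin> U n" for a
      unfolding null_iff[OF that(1), symmetric] using that U by (intro small) auto
    show "finite {n. a n \<in> U k}" if a: "range a \<subseteq> B" "order_null B a" for a k
    proof -
      \<comment> \<open>Each term in \<open>U k\<close> is replaced by a member of
        \<open>C k\<close> below it, and every other term by the empty set. The new sequence lies
        below \<open>a\<close>, hence is null, and meets \<open>C k\<close> wherever
        \<open>a\<close> meets \<open>U k\<close>.\<close>
      define b where "b n = (if a n \<in> U k then (SOME c. c \<in> C k \<and> c \<subseteq> a n) else {})" for n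
      have b: "b n \<in> C k \<and> b n \<subseteq> a n" if "a n \<in> U k" for n
      proof -
        have "\<exists>c. c \<in> C k \<and> c \<subseteq> a n" using that by (auto simp: U_def)
        from someI_ex[OF this] show ?thesis using that by (simp add: b_def)
      qed
      have b0: "b n = {}" if "a n \<notin> U k" for n using that by (simp add: b_def)
      have "b n \<in> B" for n using b[of n] b0[of n] CB(1)[of "b n" k] by (cases "a n \<in> U k") auto
      then have bB: "range b \<subseteq> B" by auto
      have "b n \<subseteq> a n" for n using b[of n] b0[of n] by (cases "a n \<in> U k") auto
      then have "order_null B b" by (rule order_null_subset[OF a(2)])
      then have "finite {n. b n \<in> C k}" using bB null_iff[OF bB] by (intro null) auto
      then show ?thesis by (rule rev_finite_subset) (use b in auto)
    qed
  qed
  show ?thesis by (rule exists_boolean_measure)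
qed

theorem theorem1p3:
  fixes X :: "'a set" and B :: "'a set set"
  assumes "boolean_sigma_algebra X B"
  shows "measure_algebra X B \<longleftrightarrow>
    (\<exists>C :: nat \<Rightarrow> 'a set set.
       (\<forall>n. C n \<subseteq> bpos B) \<and> bpos B = (\<Union>n. C n) \<and>
       (\<forall>n. \<exists>K :: nat. \<forall>A. antichain_in B A \<and> A \<subseteq> C n \<longrightarrow> finite A \<and> card A \<le> K) \<and>
       (\<forall>a :: nat \<Rightarrow> 'a set. range a \<subseteq> B \<and> (\<forall>n. a n \<notin> C n) \<longrightarrow> blim B a {}) \<and>
       (\<forall>k. \<forall>a :: nat \<Rightarrow> 'a set. range a \<subseteq> B \<and> blim B a {} \<longrightarrow> finite {n. a n \<in> C k}))"
    (is "_ \<longleftrightarrow> (\<exists>C. ?family C)")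
proof
  interpret boolean_sigma X B by unfold_locales (rule assms)
  {
    assume "measure_algebra X B"
    then obtain m where "boolean_measure X B m" by (auto simp: measure_algebra_def)
    then interpret boolean_measured X B m by unfold_locales
    show "\<exists>C. ?family C"
    proof (rule exI[of _ level], intro conjI)
      show "\<forall>n. level n \<subseteq> bpos B" by (intro allI level_subset)
      show "bpos B = (\<Union>n. level n)" by (rule bpos_eq_levels)
      show "\<forall>n. \<exists>K::nat. \<forall>A. antichain_in B A \<and> A \<subseteq> level n \<longrightarrow> finite A \<and> card A \<le> K"
      proof
        show "\<exists>K::nat. \<forall>A. antichain_in B A \<and> A \<subseteq> level n \<longrightarrow> finite A \<and> card A \<le> K" for n
          by (rule exI[of _ "2 ^ n"]) (intro allI impI antichain_level; simp)
      qed
      show "\<forall>a. range a \<subseteq> B \<and> (\<forall>n. a n \<notin> level n) \<longrightarrow> blim B a {}"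
        by (intro allI impI blim_empty_of_notin_level) simp_all
      show "\<forall>k a. range a \<subseteq> B \<and> blim B a {} \<longrightarrow> finite {n. a n \<in> level k}"
        by (intro allI impI finite_level_of_blim_empty) simp_all
    qed
  }
  {
    assume "\<exists>C. ?family C"
    then obtain C where family: "?family C" ..
    have "\<exists>m. boolean_measure X B m"
    proof (rule exists_boolean_measure_of_family)
      show "C n \<subseteq> bpos B" for n using family by (elim conjE) (rule spec)
      show "bpos B = (\<Union>n. C n)" using family by (elim conjE)
      show "\<exists>K::nat. \<forall>A. antichain_in B A \<and> A \<subseteq> C n \<longrightarrow> finite A \<and> card A \<le> K" for n
        using family by (elim conjE) (rule spec)
      show "blim B a {}" if "range a \<subseteq> B" "\<And>n. a n \<notin> C n" for a
        using family that by (elim conjE) simp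
      show "finite {n. a n \<in> C k}" if "range a \<subseteq> B" "blim B a {}" for a k
        using family that by (elim conjE) simp
    qed
    then show "measure_algebra X B" using assms by (simp add: measure_algebra_def)
  }
qed

end
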